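(* Let $N\ge2$ and let $V,W\colon\mathbb{R}^N\to\mathbb{R}$ be continuous with $\inf_{\mathbb{R}^N}V>0$ and $\inf_{\mathbb{R}^N}W>0$. Suppose there exist a function $\phi\colon\mathbb{R}^N\to\mathbb{R}_+$ with $\phi(x)\to0$ as $|x|\to+\infty$, numbers $\bar\tau>2$, $\tilde R>0$ and a constant $C>0$ such that \[ W(x)\le C\,\phi(x)\,V(x)\,|x|^{\frac{(N-1)(\bar\tau-2)}{2}}\quad\text{whenever }|x|\ge\tilde R . \] Then $H^1_{V,\mathrm{rad}}(\mathbb{R}^N)$ is compactly embedded in $L^\tau_{W,\mathrm{rad}}(\mathbb{R}^N)$ for all $\tau\ge\bar\tau$ if $N=2$, and for all $\bar\tau\le\tau<2^*=\frac{2N}{N-2}$ if $N\ge3$.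
   Context: $H^1_V(\mathbb{R}^N)$ is the completion of $C_0^\infty(\mathbb{R}^N)$ with respect to the norm $\|u\|_V=\left(\int_{\mathbb{R}^N}(|\nabla u|^2+V(x)|u|^2)\,dx\right)^{1/2}$; $L^\tau_W(\mathbb{R}^N)$ is the space of measurable $u$ with $\int_{\mathbb{R}^N}W(x)|u|^\tau dx<+\infty$, normed by $\left(\int W|u|^\tau\right)^{1/\tau}$. $H^1_{V,\mathrm{rad}}(\mathbb{R}^N)$ and $L^\tau_{W,\mathrm{rad}}(\mathbb{R}^N)$ denote the subsets of radially symmetric functions in $H^1_V(\mathbb{R}^N)$ and $L^\tau_W(\mathbb{R}^N)$ respectively. *)

theory Defs
  imports "HOL-Analysis.Analysis"
begin

text \<open>Infinitely differentiable real-valued functions on a Euclidean space: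
  f is differentiable everywhere and all first partial derivatives are again
  infinitely differentiable (greatest fixed point = C-infinity).\<close>
coinductive smooth_fun :: "('a::euclidean_space \<Rightarrow> real) \<Rightarrow> bool" where
  "(\<forall>x. f differentiable (at x)) \<Longrightarrow>
   (\<forall>b\<in>Basis. smooth_fun (\<lambda>x. frechet_derivative f (at x) b)) \<Longrightarrow> smooth_fun f"

definition C0_inf :: "('a::euclidean_space \<Rightarrow> real) set" where
  "C0_inf = {f. smooth_fun f \<and> compact (closure {x. f x \<noteq> 0})}"

definition grad_sq :: "('a::euclidean_space \<Rightarrow> real) \<Rightarrow> 'a \<Rightarrow> real" where
  "grad_sq f x = (\<Sum>b\<in>Basis. (frechet_derivative f (at x) b)\<^sup>2)"

definition normV_sq :: "('a::euclidean_space \<Rightarrow> real) \<Rightarrow> ('a \<Rightarrow> real) \<Rightarrow> ennreal" where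
  "normV_sq V f = (\<integral>\<^sup>+ x. ennreal (grad_sq f x + V x * (f x)\<^sup>2) \<partial>lebesgue)"

text \<open>H^1_V as the completion of C_0^infinity: (representatives of) functions u that
  are L^2 limits of sequences in C_0^infinity which are Cauchy for the V-norm
  (since inf V > 0, the completion embeds into L^2).  An element is bounded by M
  when it admits such an approximating sequence with V-norms at most M.\<close>
definition H1V_approx :: "('a::euclidean_space \<Rightarrow> real) \<Rightarrow> ('a \<Rightarrow> real) \<Rightarrow> (nat \<Rightarrow> 'a \<Rightarrow> real) \<Rightarrow> bool" where
  "H1V_approx V u \<phi> \<longleftrightarrow>
     (\<forall>k. \<phi> k \<in> C0_inf) \<and>
     (\<forall>e>0. \<exists>K. \<forall>m\<ge>K. \<forall>n\<ge>K. normV_sq V (\<lambda>x. \<phi> m x - \<phi> n x) < ennreal e) \<and>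
     ((\<lambda>k. \<integral>\<^sup>+ x. ennreal ((\<phi> k x - u x)\<^sup>2) \<partial>lebesgue) \<longlonglongrightarrow> 0)"

definition H1V :: "('a::euclidean_space \<Rightarrow> real) \<Rightarrow> ('a \<Rightarrow> real) set" where
  "H1V V = {u. u \<in> borel_measurable lebesgue \<and> (\<exists>\<phi>. H1V_approx V u \<phi>)}"

definition H1V_bounded_by :: "('a::euclidean_space \<Rightarrow> real) \<Rightarrow> real \<Rightarrow> ('a \<Rightarrow> real) \<Rightarrow> bool" where
  "H1V_bounded_by V M u \<longleftrightarrow> u \<in> borel_measurable lebesgue \<and>
     (\<exists>\<phi>. H1V_approx V u \<phi> \<and> (\<forall>k. normV_sq V (\<phi> k) \<le> ennreal (M\<^sup>2)))"

definition LW :: "('a::euclidean_space \<Rightarrow> real) \<Rightarrow> real \<Rightarrow> ('a \<Rightarrow> real) set" where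
  "LW W \<tau> = {u. u \<in> borel_measurable lebesgue \<and>
              (\<integral>\<^sup>+ x. ennreal (W x * \<bar>u x\<bar> powr \<tau>) \<partial>lebesgue) < \<infinity>}"

definition radial :: "('a::euclidean_space \<Rightarrow> real) \<Rightarrow> bool" where
  "radial u \<longleftrightarrow> (\<forall>x y. norm x = norm y \<longrightarrow> u x = u y)"

definition H1V_rad :: "('a::euclidean_space \<Rightarrow> real) \<Rightarrow> ('a \<Rightarrow> real) set" where "H1V_rad V = {u \<in> H1V V. radial u}"
definition LW_rad :: "('a::euclidean_space \<Rightarrow> real) \<Rightarrow> real \<Rightarrow> ('a \<Rightarrow> real) set" where "LW_rad W \<tau> = {u \<in> LW W \<tau>. radial u}"

definition compact_embedding_rad ::
  "('a::euclidean_space \<Rightarrow> real) \<Rightarrow> ('a \<Rightarrow> real) \<Rightarrow> real \<Rightarrow> bool" where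
  "compact_embedding_rad V W \<tau> \<longleftrightarrow>
     H1V_rad V \<subseteq> LW_rad W \<tau> \<and>
     (\<forall>(u::nat \<Rightarrow> 'a \<Rightarrow> real) M. (\<forall>n. u n \<in> H1V_rad V \<and> H1V_bounded_by V M (u n)) \<longrightarrow>
        (\<exists>r v. strict_mono r \<and> v \<in> LW_rad W \<tau> \<and>
           ((\<lambda>n. \<integral>\<^sup>+ x. ennreal (W x * \<bar>u (r n) x - v x\<bar> powr \<tau>) \<partial>lebesgue) \<longlonglongrightarrow> 0)))"

end

theory Submission
  imports Defs "HOL-Complex_Analysis.Great_Picard"
begin

text \<open>
  For \<open>f\<close> continuously differentiable with compact support, integration along rays writes the
  spherical mean of \<open>f\<close> over the sphere of radius \<open>r\<close> as a volume integral of the radial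
  derivative over \<open>norm y \<ge> r\<close>. The Cauchy-Schwarz inequality then bounds the mean, in terms of the
  \<open>H\<^sup>1\<close> norm of \<open>f\<close>, by a multiple of \<open>r powr - (N - 1) / 2\<close> for \<open>r \<ge> 1\<close> (Strauss' estimate) and
  of \<open>r powr - \<alpha>\<close> for \<open>r \<le> 1\<close> and any \<open>\<alpha> > (N - 2) / 2\<close>, and makes it locally
  Hoelder continuous away from \<open>0\<close>. Taking limits, every radial function of the space has a continuous
  profile with the same bounds. A bounded sequence of profiles has a pointwise convergent
  subsequence. Because \<open>\<tau>\<close> is subcritical, \<open>\<alpha>\<close> can be chosen with \<open>\<alpha> * \<tau> < N\<close>, so dominated
  convergence applies on balls; outside large balls the decay of the profiles and the hypothesis
  on \<open>W\<close> bound the \<open>W\<close>-integral by a small multiple of the \<open>V\<close>-integral.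
\<close>

lemma integral_Cauchy_Schwarz:
  fixes f g :: "'b \<Rightarrow> real"
  assumes [measurable]: "f \<in> borel_measurable M" "g \<in> borel_measurable M"
    and f: "integrable M (\<lambda>x. (f x)\<^sup>2)" and g: "integrable M (\<lambda>x. (g x)\<^sup>2)"
  shows "integrable M (\<lambda>x. f x * g x)"
    and "(\<integral>x. \<bar>f x * g x\<bar> \<partial>M) \<le> sqrt ((\<integral>x. (f x)\<^sup>2 \<partial>M) * (\<integral>x. (g x)\<^sup>2 \<partial>M))"
proof -
  have "integrable M (\<lambda>x. (f x)\<^sup>2 + (g x)\<^sup>2)" using f g by simp
  then show fg: "integrable M (\<lambda>x. f x * g x)"
  proof (rule Bochner_Integration.integrable_bound)
    have "\<bar>a * b\<bar> \<le> a\<^sup>2 + b\<^sup>2" for a b :: real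
      using sum_squares_bound[of a b] sum_squares_bound[of a "-b"] zero_le_power2[of a] zero_le_power2[of b]
      by (auto simp: abs_if)
    then show "AE x in M. norm (f x * g x) \<le> norm ((f x)\<^sup>2 + (g x)\<^sup>2)" by (auto simp: abs_mult)
  qed simp
  have "(\<integral>\<^sup>+x. ennreal \<bar>f x\<bar> * ennreal \<bar>g x\<bar> \<partial>M)\<^sup>2
     \<le> (\<integral>\<^sup>+x. (ennreal \<bar>f x\<bar>)\<^sup>2 \<partial>M) * (\<integral>\<^sup>+x. (ennreal \<bar>g x\<bar>)\<^sup>2 \<partial>M)"
    by (rule Cauchy_Schwarz_nn_integral) auto
  then have "(\<integral>\<^sup>+x. ennreal \<bar>f x * g x\<bar> \<partial>M)\<^sup>2
     \<le> (\<integral>\<^sup>+x. ennreal ((f x)\<^sup>2) \<partial>M) * (\<integral>\<^sup>+x. ennreal ((g x)\<^sup>2) \<partial>M)"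
    by (simp add: ennreal_power ennreal_mult[symmetric] abs_mult)
  then have "(\<integral>x. \<bar>f x * g x\<bar> \<partial>M)\<^sup>2 \<le> (\<integral>x. (f x)\<^sup>2 \<partial>M) * (\<integral>x. (g x)\<^sup>2 \<partial>M)"
    using fg f g by (simp add: nn_integral_eq_integral ennreal_power ennreal_mult[symmetric])
  then show "(\<integral>x. \<bar>f x * g x\<bar> \<partial>M) \<le> sqrt ((\<integral>x. (f x)\<^sup>2 \<partial>M) * (\<integral>x. (g x)\<^sup>2 \<partial>M))"
    by (simp add: real_le_rsqrt)
qed

section \<open>Polar integration of radial functions\<close>

definition sphere_area :: "'a::euclidean_space itself \<Rightarrow> real" where
  "sphere_area _ = real DIM('a) * unit_ball_vol (real DIM('a))"

lemma sphere_area_pos: "sphere_area TYPE('a::euclidean_space) > 0"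
  by (simp add: sphere_area_def)

lemma distr_norm_lborel:
  "distr (lborel :: 'a::euclidean_space measure) borel norm =
    density lborel (\<lambda>s. ennreal (indicator {0..} s * (sphere_area TYPE('a) * s ^ (DIM('a) - 1))))"
  (is "?M = ?N")
proof (rule measure_eqI_generator_eq[where E = "range atMost" and \<Omega> = UNIV and A = "\<lambda>n. {..real n}"])
  have DIM: "DIM('a) > 0" by simp
  have M: "emeasure ?M {..r} = (if r < 0 then 0 else ennreal (unit_ball_vol (real DIM('a)) * r ^ DIM('a)))" for r
  proof -
    have "emeasure ?M {..r} = emeasure lborel (cball 0 r :: 'a set)"
      by (subst emeasure_distr) (auto simp: cball_def vimage_def intro!: arg_cong[where f = "emeasure lborel"])
    then show ?thesis by (auto simp: emeasure_cball)
  qed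
  have N: "emeasure ?N {..r} = (if r < 0 then 0 else ennreal (unit_ball_vol (real DIM('a)) * r ^ DIM('a)))" for r
  proof (cases "r < 0")
    case True
    have "emeasure ?N {..r} = (\<integral>\<^sup>+s. 0 \<partial>(lborel :: real measure))"
      by (subst emeasure_density; (rule nn_integral_cong)?) (use True in \<open>auto simp: indicator_def\<close>)
    then show ?thesis using True by simp
  next
    case False
    have "emeasure ?N {..r} = (\<integral>\<^sup>+s. ennreal (sphere_area TYPE('a) * s ^ (DIM('a) - 1)) * indicator {0..r} s \<partial>lborel)"
      by (subst emeasure_density; (rule nn_integral_cong)?) (auto simp: indicator_def)
    also have "\<dots> = ennreal (unit_ball_vol (real DIM('a)) * r ^ DIM('a) - unit_ball_vol (real DIM('a)) * 0 ^ DIM('a))"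
      using False
      by (intro nn_integral_FTC_Icc)
        (auto intro!: derivative_eq_intros mult_nonneg_nonneg simp: sphere_area_def)
    finally show ?thesis using False by simp
  qed
  show "emeasure ?M X = emeasure ?N X" if "X \<in> range atMost" for X
    using that by (auto simp only: M N)
  show "emeasure ?M {..real n} \<noteq> \<infinity>" for n by (simp add: M)
  show "Int_stable (range (atMost :: real \<Rightarrow> _))"
    by (auto simp: Int_stable_def)
  show "sets ?M = sigma_sets UNIV (range atMost)" "sets ?N = sigma_sets UNIV (range atMost)"
    by (auto simp: borel_eq_atMost)
  show "(\<Union>i. {..real i}) = UNIV" using real_arch_simple by auto
qed auto

lemma
  fixes h :: "real \<Rightarrow> real"
  assumes [measurable]: "h \<in> borel_measurable borel"
  defines "w \<equiv> \<lambda>s. indicator {0..} s * (sphere_area TYPE('a::euclidean_space) * s ^ (DIM('a) - 1))"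
  shows integrable_norm_lborel_iff:
      "integrable lborel (\<lambda>x::'a. h (norm x)) \<longleftrightarrow> integrable lborel (\<lambda>s. w s * h s)"
    and integral_norm_lborel: "(\<integral>x. h (norm (x::'a)) \<partial>lborel) = (\<integral>s. w s * h s \<partial>lborel)"
proof -
  have [measurable]: "w \<in> borel_measurable borel" unfolding w_def by measurable
  have d: "distr (lborel :: 'a measure) borel norm = density lborel (\<lambda>s. ennreal (w s))"
    unfolding w_def by (rule distr_norm_lborel)
  have w: "AE s in lborel. 0 \<le> w s"
    using sphere_area_pos[where 'a = 'a] by (auto simp: w_def indicator_def)
  have "integrable lborel (\<lambda>x::'a. h (norm x)) \<longleftrightarrow> integrable (distr (lborel :: 'a measure) borel norm) h"
    by (subst integrable_distr_eq) auto
  then show "integrable lborel (\<lambda>x::'a. h (norm x)) \<longleftrightarrow> integrable lborel (\<lambda>s. w s * h s)"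
    unfolding d using w by (simp add: integrable_density)
  have "(\<integral>x. h (norm (x::'a)) \<partial>lborel) = integral\<^sup>L (distr (lborel :: 'a measure) borel norm) h"
    by (subst integral_distr) auto
  then show "(\<integral>x. h (norm (x::'a)) \<partial>lborel) = (\<integral>s. w s * h s \<partial>lborel)"
    unfolding d using w by (simp add: integral_density)
qed

lemma integral_lborel_scale:
  fixes g :: "'a::euclidean_space \<Rightarrow> real"
  assumes [measurable]: "g \<in> borel_measurable borel" and c: "0 < c"
  shows "(\<integral>x. g x \<partial>lborel) = c ^ DIM('a) * (\<integral>x. g (c *\<^sub>R x) \<partial>lborel)"
proof -
  have "(\<integral>x. g x \<partial>lborel) =
      (\<integral>x. g x \<partial>density (distr lborel borel (\<lambda>x::'a. 0 + c *\<^sub>R x)) (\<lambda>_. ennreal (\<bar>c\<bar> ^ DIM('a))))"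
    using c by (subst lborel_affine[of c 0]) (auto simp: ennreal_power)
  also have "\<dots> = (\<integral>x. c ^ DIM('a) * g x \<partial>distr lborel borel (\<lambda>x::'a. 0 + c *\<^sub>R x))"
    using c by (subst integral_density) auto
  also have "\<dots> = c ^ DIM('a) * (\<integral>x. g (c *\<^sub>R x) \<partial>lborel)"
    by (subst integral_distr) auto
  finally show ?thesis .
qed

section \<open>Spherical means\<close>

definition C1c :: "('a::euclidean_space \<Rightarrow> real) \<Rightarrow> bool" where
  "C1c f \<longleftrightarrow> (\<forall>x. f differentiable (at x)) \<and>
     (\<forall>b\<in>Basis. continuous_on UNIV (\<lambda>x. frechet_derivative f (at x) b)) \<and>
     (\<exists>\<rho>>0. \<forall>x. \<rho> < norm x \<longrightarrow> f x = 0)"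

definition radial_deriv :: "('a::euclidean_space \<Rightarrow> real) \<Rightarrow> 'a \<Rightarrow> real" where
  "radial_deriv f x = frechet_derivative f (at x) x"

lemma C1c_has_derivative: "C1c f \<Longrightarrow> (f has_derivative frechet_derivative f (at x)) (at x)"
  by (simp add: C1c_def frechet_derivative_works)

lemma C1c_continuous: "C1c f \<Longrightarrow> continuous_on UNIV f"
  by (meson C1c_has_derivative continuous_at_imp_continuous_on has_derivative_continuous)

lemma C1c_borel: "C1c f \<Longrightarrow> f \<in> borel_measurable borel"
  by (simp add: C1c_continuous borel_measurable_continuous_onI)

lemma C0_inf_imp_C1c:
  assumes "f \<in> C0_inf"
  shows "C1c f"
proof -
  from assms have f: "smooth_fun f" and K: "compact (closure {x. f x \<noteq> 0})"
    by (auto simp: C0_inf_def)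
  have d: "\<forall>x. g differentiable (at x)" if "smooth_fun g" for g :: "'a \<Rightarrow> real"
    using that by (cases rule: smooth_fun.cases) auto
  have "\<forall>b\<in>Basis. smooth_fun (\<lambda>x. frechet_derivative f (at x) b)"
    using f by (cases rule: smooth_fun.cases) auto
  then have c: "\<forall>b\<in>Basis. continuous_on UNIV (\<lambda>x. frechet_derivative f (at x) b)"
    using d by (meson continuous_at_imp_continuous_on differentiable_imp_continuous_within)
  obtain \<rho> where "\<rho> > 0" "\<And>x. x \<in> closure {x. f x \<noteq> 0} \<Longrightarrow> norm x \<le> \<rho>"
    using compact_imp_bounded[OF K] unfolding bounded_pos by blast
  then have "\<exists>\<rho>>0. \<forall>x. \<rho> < norm x \<longrightarrow> f x = 0"
    using closure_subset[of "{x. f x \<noteq> 0}"] by (metis (mono_tags, lifting) mem_Collect_eq not_le subsetD)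
  then show ?thesis using d[OF f] c by (simp add: C1c_def)
qed

lemma frechet_derivative_diff:
  assumes "C1c f" "C1c g"
  shows "frechet_derivative (\<lambda>x. f x - g x) (at x) =
    (\<lambda>h. frechet_derivative f (at x) h - frechet_derivative g (at x) h)"
  using C1c_has_derivative[OF assms(1), of x] C1c_has_derivative[OF assms(2), of x]
  by (intro frechet_derivative_at[symmetric] has_derivative_diff)

lemma C1c_diff:
  assumes "C1c f" "C1c g"
  shows "C1c (\<lambda>x. f x - g x)"
proof -
  from assms obtain \<rho> \<sigma> where "\<rho> > 0" "\<forall>x. \<rho> < norm x \<longrightarrow> f x = 0" "\<sigma> > 0" "\<forall>x. \<sigma> < norm x \<longrightarrow> g x = 0"
    unfolding C1c_def by blast
  then have "\<exists>\<rho>>0. \<forall>x. \<rho> < norm x \<longrightarrow> f x - g x = 0"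
    by (intro exI[of _ "max \<rho> \<sigma>"]) auto
  then show ?thesis
    using assms unfolding C1c_def frechet_derivative_diff[OF assms]
    by (auto intro!: continuous_on_diff)
qed

lemma radial_deriv_diff:
  "C1c f \<Longrightarrow> C1c g \<Longrightarrow> radial_deriv (\<lambda>x. f x - g x) x = radial_deriv f x - radial_deriv g x"
  by (simp add: radial_deriv_def frechet_derivative_diff)

lemma C1c_support:
  assumes "C1c f"
  obtains \<rho> where "\<rho> > 0" "\<And>x. \<rho> < norm x \<Longrightarrow> f x = 0"
    "\<And>x. \<rho> < norm x \<Longrightarrow> frechet_derivative f (at x) = (\<lambda>_. 0)"
proof -
  obtain \<rho> where \<rho>: "\<rho> > 0" "\<And>x. \<rho> < norm x \<Longrightarrow> f x = 0"
    using assms unfolding C1c_def by blast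
  have "frechet_derivative f (at x) = (\<lambda>_. 0)" if "\<rho> < norm x" for x
  proof -
    have "open {x::'a. \<rho> < norm x}" by (intro open_Collect_less continuous_intros)
    moreover have "(\<lambda>_. 0) y = f y" if "y \<in> {x. \<rho> < norm x}" for y
      using \<rho>(2)[of y] that by simp
    moreover have "x \<in> {x. \<rho> < norm x}" using that by simp
    ultimately have "(f has_derivative (\<lambda>_. 0)) (at x)"
      by (intro has_derivative_transform_within_open[where f = "\<lambda>_. 0" and g = f]) (rule has_derivative_const)
    from frechet_derivative_at[OF this] show ?thesis by (rule sym)
  qed
  with \<rho> show ?thesis using that by blast
qed

lemma radial_deriv_eq_sum:
  assumes "C1c f"
  shows "radial_deriv f x = (\<Sum>b\<in>Basis. (x \<bullet> b) * frechet_derivative f (at x) b)"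
proof -
  have l: "linear (frechet_derivative f (at x))"
    using C1c_has_derivative[OF assms, of x] has_derivative_linear by blast
  have "radial_deriv f x = frechet_derivative f (at x) (\<Sum>b\<in>Basis. (x \<bullet> b) *\<^sub>R b)"
    by (simp add: radial_deriv_def euclidean_representation)
  then show ?thesis by (simp add: linear_sum[OF l] linear_cmul[OF l])
qed

lemma radial_deriv_continuous:
  assumes "C1c f"
  shows "continuous_on UNIV (radial_deriv f)"
proof -
  have "continuous_on UNIV (\<lambda>x. \<Sum>b\<in>Basis. (x \<bullet> b) * frechet_derivative f (at x) b)"
    using assms unfolding C1c_def
    by (intro continuous_on_sum continuous_on_mult continuous_on_inner continuous_on_id continuous_on_const) blast
  then show ?thesis
    by (simp only: radial_deriv_eq_sum[OF assms, symmetric])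
qed

lemma grad_sq_continuous: "C1c f \<Longrightarrow> continuous_on UNIV (grad_sq f)"
  unfolding grad_sq_def[abs_def] C1c_def by (intro continuous_on_sum continuous_on_power) blast

lemma grad_sq_nonneg: "0 \<le> grad_sq f x"
  by (simp add: grad_sq_def sum_nonneg)

lemma abs_radial_deriv_le:
  assumes "C1c f"
  shows "\<bar>radial_deriv f x\<bar> \<le> sqrt (grad_sq f x) * norm x"
proof -
  have "(radial_deriv f x)\<^sup>2 \<le> (\<Sum>b\<in>Basis. (x \<bullet> b)\<^sup>2) * grad_sq f x"
    unfolding radial_deriv_eq_sum[OF assms] grad_sq_def by (rule Cauchy_Schwarz_ineq_sum)
  also have "(\<Sum>b\<in>Basis. (x \<bullet> b)\<^sup>2) = (norm x)\<^sup>2"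
    unfolding power2_norm_eq_inner euclidean_inner[of x x] by (simp only: power2_eq_square)
  finally have "\<bar>radial_deriv f x\<bar> \<le> sqrt ((norm x)\<^sup>2 * grad_sq f x)"
    by (intro real_le_rsqrt) (simp only: power2_abs)
  also have "\<dots> = sqrt (grad_sq f x) * norm x"
    by (simp only: real_sqrt_mult real_sqrt_abs abs_norm_cancel mult.commute)
  finally show ?thesis .
qed

lemma integrable_continuous_bounded_support:
  fixes h :: "'a::euclidean_space \<Rightarrow> real"
  assumes "continuous_on UNIV h" "\<And>x. \<rho> < norm x \<Longrightarrow> h x = 0"
  shows "integrable lborel h"
proof -
  have "integrable lborel (\<lambda>x. indicator (cball 0 \<rho>) x *\<^sub>R h x)"
    using assms(1) by (intro borel_integrable_compact) (auto intro: continuous_on_subset)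
  also have "(\<lambda>x. indicator (cball 0 \<rho>) x *\<^sub>R h x) = h"
    using assms(2) by (auto simp: indicator_def fun_eq_iff)
  finally show ?thesis .
qed

lemma
  assumes f: "C1c f"
  shows C1c_integrable_power2: "integrable lborel (\<lambda>x. (f x)\<^sup>2)"
    and grad_sq_integrable: "integrable lborel (grad_sq f)"
    and radial_deriv_integrable: "integrable lborel (radial_deriv f)"
proof -
  obtain \<rho> where "0 < \<rho>" and \<rho>: "\<And>x. \<rho> < norm x \<Longrightarrow> f x = 0"
    "\<And>x. \<rho> < norm x \<Longrightarrow> frechet_derivative f (at x) = (\<lambda>_. 0)" using C1c_support[OF f] by blast
  note int = integrable_continuous_bounded_support[where \<rho> = \<rho>]
  show "integrable lborel (\<lambda>x. (f x)\<^sup>2)"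
    by (rule int) (auto intro!: continuous_intros C1c_continuous[OF f] simp: \<rho>)
  show "integrable lborel (grad_sq f)"
    by (rule int[OF grad_sq_continuous[OF f]]) (simp add: grad_sq_def \<rho>)
  show "integrable lborel (radial_deriv f)"
    by (rule int[OF radial_deriv_continuous[OF f]]) (simp add: radial_deriv_def \<rho>)
qed

text \<open>For continuously differentiable \<open>f\<close> of compact support this is the mean of \<open>f\<close>
  over the sphere of radius \<open>r > 0\<close>, written as a volume integral by integrating \<open>f\<close>
  along rays.\<close>
definition sph_mean :: "('a::euclidean_space \<Rightarrow> real) \<Rightarrow> real \<Rightarrow> real" where
  "sph_mean f r = - (\<integral>y. indicator {y. r \<le> norm y} y * (radial_deriv f y / norm y ^ DIM('a)) \<partial>lborel)
     / sphere_area TYPE('a)"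

lemma divide_power_le:
  fixes r s t :: real
  assumes "0 < r" "r \<le> s"
  shows "\<bar>t / s ^ n\<bar> \<le> \<bar>t / r ^ n\<bar>"
proof -
  have "r ^ n \<le> s ^ n" "0 < r ^ n" using assms by (auto intro: power_mono)
  then have "\<bar>t\<bar> / s ^ n \<le> \<bar>t\<bar> / r ^ n"
    by (intro divide_left_mono) auto
  moreover have "\<bar>s ^ n\<bar> = s ^ n" "\<bar>r ^ n\<bar> = r ^ n" using assms by auto
  ultimately show ?thesis by (simp only: abs_divide)
qed

lemma sph_mean_integrand_integrable:
  fixes f :: "'a::euclidean_space \<Rightarrow> real"
  assumes f: "C1c f" and r: "r > 0"
  shows "integrable lborel (\<lambda>y. indicator {y. r \<le> norm y} y * (radial_deriv f y / norm y ^ DIM('a)))"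
proof (rule Bochner_Integration.integrable_bound)
  show "integrable lborel (\<lambda>y. radial_deriv f y / r ^ DIM('a))"
    using radial_deriv_integrable[OF f] by simp
  have [measurable]: "radial_deriv f \<in> borel_measurable borel"
    using f by (simp add: radial_deriv_continuous borel_measurable_continuous_onI)
  show "(\<lambda>y. indicator {y. r \<le> norm y} y * (radial_deriv f y / norm y ^ DIM('a))) \<in> borel_measurable lborel"
    by measurable
  show "AE y in lborel. norm (indicator {y. r \<le> norm y} y * (radial_deriv f y / norm y ^ DIM('a)))
     \<le> norm (radial_deriv f y / r ^ DIM('a))"
  proof (rule AE_I2)
    fix y :: 'a
    show "norm (indicator {y. r \<le> norm y} y * (radial_deriv f y / norm y ^ DIM('a)))
       \<le> norm (radial_deriv f y / r ^ DIM('a))"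
    proof (cases "r \<le> norm y")
      case True
      have "norm (indicator {y. r \<le> norm y} y * (radial_deriv f y / norm y ^ DIM('a)))
          = \<bar>radial_deriv f y / norm y ^ DIM('a)\<bar>"
        using True by (simp only: indicator_simps mem_Collect_eq mult_1 real_norm_def)
      then show ?thesis using divide_power_le[OF r True] by (simp only: real_norm_def)
    next
      case False
      then have "indicator {y. r \<le> norm y} y = (0::real)" by (simp add: indicator_def)
      then show ?thesis by (simp only: mult_zero_left norm_zero norm_ge_zero)
    qed
  qed
qed

lemma sph_mean_diff:
  fixes f g :: "'a::euclidean_space \<Rightarrow> real"
  assumes "C1c f" "C1c g" "r > 0"
  shows "sph_mean (\<lambda>x. f x - g x) r = sph_mean f r - sph_mean g r"
proof -
  let ?G = "\<lambda>f y. indicator {y. r \<le> norm y} y * (radial_deriv f y / norm y ^ DIM('a))"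
  have "?G (\<lambda>x. f x - g x) y = ?G f y - ?G g y" for y
    by (simp only: radial_deriv_diff[OF assms(1,2)] diff_divide_distrib right_diff_distrib)
  then have "(\<integral>y. ?G (\<lambda>x. f x - g x) y \<partial>lborel) = (\<integral>y. ?G f y - ?G g y \<partial>lborel)"
    by (intro Bochner_Integration.integral_cong refl)
  also have "\<dots> = (\<integral>y. ?G f y \<partial>lborel) - (\<integral>y. ?G g y \<partial>lborel)"
    by (intro Bochner_Integration.integral_diff sph_mean_integrand_integrable assms)
  finally show ?thesis
    unfolding sph_mean_def by (simp only: diff_divide_distrib minus_diff_eq minus_divide_left[symmetric])
qed

lemma sph_mean_borel:
  fixes f :: "'a::euclidean_space \<Rightarrow> real"
  assumes "C1c f"
  shows "sph_mean f \<in> borel_measurable borel"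
proof -
  have [measurable]: "radial_deriv f \<in> borel_measurable borel"
    using assms by (simp add: radial_deriv_continuous borel_measurable_continuous_onI)
  have "(\<lambda>(r, y). if r \<le> norm y then radial_deriv f y / norm y ^ DIM('a) else 0)
      \<in> borel_measurable (borel \<Otimes>\<^sub>M lborel)"
    by measurable
  then have M: "(\<lambda>r. \<integral>y. (if r \<le> norm y then radial_deriv f y / norm y ^ DIM('a) else 0) \<partial>lborel)
      \<in> borel_measurable borel"
    by (rule lborel.borel_measurable_lebesgue_integral)
  have ind: "indicator {y. r \<le> norm y} y * t = (if r \<le> norm y then t else 0)" for r t :: real and y :: 'a
    by simp
  show ?thesis
    unfolding sph_mean_def[abs_def] ind
    by (rule borel_measurable_divide[OF borel_measurable_uminus[OF M] borel_measurable_const])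
qed

section \<open>Pointwise estimates for spherical means\<close>

definition radial_weight :: "nat \<Rightarrow> real \<Rightarrow> real \<Rightarrow> real" where
  "radial_weight n r s = (\<integral>t. indicator {r..<s} t / t ^ n \<partial>lborel)"

lemma radial_weight_integrable:
  fixes r s :: real
  assumes "0 < r"
  shows "integrable lborel (\<lambda>t. indicator {r..<s} t / t ^ n)"
proof (rule Bochner_Integration.integrable_bound)
  show "integrable lborel (\<lambda>t. indicator {r..<s} t / r ^ n)"
  proof -
    have "integrable lborel (indicator {r..<s} :: real \<Rightarrow> real)"
      by (cases "r \<le> s") (auto intro!: integrable_real_indicator)
    then show ?thesis by simp
  qed
  show "AE t in lborel. norm (indicator {r..<s} t / t ^ n :: real) \<le> norm (indicator {r..<s} t / r ^ n :: real)"
    using divide_power_le[OF assms, of _ 1 n] by (intro AE_I2) (auto simp: indicator_def)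
qed measurable

lemma radial_weight_nonneg: "0 < r \<Longrightarrow> 0 \<le> radial_weight n r s"
  unfolding radial_weight_def by (intro Bochner_Integration.integral_nonneg) (auto simp: indicator_def)

lemma radial_weight_le:
  assumes "0 < r" "r \<le> s"
  shows "radial_weight n r s \<le> (s - r) / r ^ n"
proof -
  have "radial_weight n r s \<le> (\<integral>t. indicator {r..<s} t / r ^ n \<partial>lborel)"
    unfolding radial_weight_def
  proof (rule integral_mono)
    show "integrable lborel (\<lambda>t. indicator {r..<s} t / r ^ n)"
    proof -
      have "integrable lborel (indicator {r..<s} :: real \<Rightarrow> real)"
        using assms by (auto intro!: integrable_real_indicator)
      then show ?thesis by simp
    qed
    show "indicator {r..<s} t / t ^ n \<le> (indicator {r..<s} t / r ^ n :: real)" for t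
      using divide_power_le[OF assms(1), of t 1 n] assms(1) by (auto simp: indicator_def)
  qed (use radial_weight_integrable assms in auto)
  also have "\<dots> = (s - r) / r ^ n"
    using assms by simp
  finally show ?thesis .
qed

lemma
  fixes r s :: real
  assumes r: "0 < r"
  defines "k \<equiv> \<lambda>y::'a::euclidean_space. indicator {y. r \<le> norm y \<and> norm y < s} y / norm y ^ (DIM('a) - 1) :: real"
  shows annulus_kernel_integrable: "integrable lborel (\<lambda>y. (k y)\<^sup>2)"
    and annulus_kernel_integral:
      "(\<integral>y. (k y)\<^sup>2 \<partial>lborel) = sphere_area TYPE('a) * radial_weight (DIM('a) - 1) r s"
proof -
  define n where "n = DIM('a) - 1"
  define h where "h = (\<lambda>t. indicator {r..<s} t / t ^ (2 * n) :: real)"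
  have [measurable]: "h \<in> borel_measurable borel" unfolding h_def by measurable
  have k: "(k y)\<^sup>2 = h (norm y)" for y
    by (simp add: k_def h_def n_def indicator_def power_divide power_mult[symmetric] mult.commute)
  have h: "indicator {0..} t * (sphere_area TYPE('a) * t ^ (DIM('a) - 1)) * h t
      = sphere_area TYPE('a) * (indicator {r..<s} t / t ^ n)" for t
    unfolding n_def[symmetric] using r by (auto simp: h_def indicator_def mult_2 power_add)
  show "integrable lborel (\<lambda>y. (k y)\<^sup>2)"
    unfolding k by (subst integrable_norm_lborel_iff)
      (use radial_weight_integrable[OF r] in \<open>auto simp only: h \<open>h \<in> _\<close> integrable_mult_right\<close>)
  show "(\<integral>y. (k y)\<^sup>2 \<partial>lborel) = sphere_area TYPE('a) * radial_weight (DIM('a) - 1) r s"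
    unfolding k by (subst integral_norm_lborel) (auto simp only: h \<open>h \<in> _\<close> integral_mult_right_zero radial_weight_def n_def)
qed

lemma sph_mean_dist_le:
  fixes f :: "'a::euclidean_space \<Rightarrow> real"
  assumes f: "C1c f" and r: "0 < r" "r \<le> s"
  shows "\<bar>sph_mean f r - sph_mean f s\<bar>
    \<le> sqrt ((\<integral>x. grad_sq f x \<partial>lborel) * radial_weight (DIM('a) - 1) r s / sphere_area TYPE('a))"
proof -
  define c where "c = sphere_area TYPE('a)"
  have c: "0 < c" unfolding c_def by (rule sphere_area_pos)
  define D where "D = (\<lambda>y. radial_deriv f y / norm y ^ DIM('a))"
  define k where "k = (\<lambda>y::'a. indicator {y. r \<le> norm y \<and> norm y < s} y / norm y ^ (DIM('a) - 1) :: real)"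
  define g where "g = (\<lambda>y. sqrt (grad_sq f y))"
  have g2: "(g y)\<^sup>2 = grad_sq f y" for y by (simp add: g_def grad_sq_nonneg)
  have [measurable]: "g \<in> borel_measurable lborel"
    using borel_measurable_continuous_onI[OF grad_sq_continuous[OF f]] unfolding g_def by measurable
  have [measurable]: "k \<in> borel_measurable lborel" unfolding k_def by measurable
  have gi: "integrable lborel (\<lambda>y. (g y)\<^sup>2)" unfolding g2 by (rule grad_sq_integrable[OF f])
  have ki: "integrable lborel (\<lambda>y. (k y)\<^sup>2)" unfolding k_def by (rule annulus_kernel_integrable[OF r(1)])
  have I: "integrable lborel (\<lambda>y. indicator {y. t \<le> norm y} y * D y)" if "0 < t" for t
    unfolding D_def using sph_mean_integrand_integrable[OF f that] .
  have eq: "indicator {y. r \<le> norm y} y * D y - indicator {y. s \<le> norm y} y * D y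
     = indicator {y. r \<le> norm y \<and> norm y < s} y * D y" for y
    using r by (auto simp: indicator_def)
  have m: "sph_mean f t = - (\<integral>y. indicator {y. t \<le> norm y} y * D y \<partial>lborel) / c" for t
    unfolding sph_mean_def D_def c_def ..
  have "sph_mean f r - sph_mean f s =
      - ((\<integral>y. indicator {y. r \<le> norm y} y * D y \<partial>lborel) - (\<integral>y. indicator {y. s \<le> norm y} y * D y \<partial>lborel)) / c"
    unfolding m by (simp add: diff_divide_distrib)
  also have "\<dots> = - (\<integral>y. indicator {y. r \<le> norm y \<and> norm y < s} y * D y \<partial>lborel) / c"
    using r by (simp only: Bochner_Integration.integral_diff[OF I I, symmetric] eq)
  finally have "\<bar>sph_mean f r - sph_mean f s\<bar> = \<bar>\<integral>y. indicator {y. r \<le> norm y \<and> norm y < s} y * D y \<partial>lborel\<bar> / c"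
    using c by simp
  also have "\<dots> \<le> (\<integral>y. \<bar>g y * k y\<bar> \<partial>lborel) / c"
  proof (rule divide_right_mono)
    have "\<bar>indicator {y. r \<le> norm y \<and> norm y < s} y * D y\<bar> \<le> \<bar>g y * k y\<bar>" for y
    proof (cases "r \<le> norm y \<and> norm y < s")
      case True
      have "\<bar>D y\<bar> = \<bar>radial_deriv f y\<bar> / (norm y * norm y ^ (DIM('a) - 1))"
        by (simp add: D_def flip: power_Suc)
      also have "\<dots> \<le> (g y * norm y) / (norm y * norm y ^ (DIM('a) - 1))"
        unfolding g_def by (intro divide_right_mono abs_radial_deriv_le f) simp
      also have "\<dots> = g y * k y"
      proof -
        have "norm y \<noteq> 0" using True r by linarith
        moreover have "k y = 1 / norm y ^ (DIM('a) - 1)" using True by (simp add: k_def)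
        ultimately show ?thesis by (simp only: mult.commute[of "g y"] nonzero_mult_divide_mult_cancel_left mult_1_right times_divide_eq_left mult_1 not_False_eq_True)
      qed
      finally show ?thesis using True by simp
    qed simp
    then have "(\<integral>y. \<bar>indicator {y. r \<le> norm y \<and> norm y < s} y * D y\<bar> \<partial>lborel) \<le> (\<integral>y. \<bar>g y * k y\<bar> \<partial>lborel)"
      by (intro integral_mono' integrable_abs integral_Cauchy_Schwarz(1)[OF _ _ gi ki]) (assumption | simp)+
    with integral_abs_bound show "\<bar>\<integral>y. indicator {y. r \<le> norm y \<and> norm y < s} y * D y \<partial>lborel\<bar> \<le> (\<integral>y. \<bar>g y * k y\<bar> \<partial>lborel)"
      by (rule order_trans)
  qed (use c in simp)
  also have "\<dots> \<le> sqrt ((\<integral>y. (g y)\<^sup>2 \<partial>lborel) * (\<integral>y. (k y)\<^sup>2 \<partial>lborel)) / c"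
    using c by (intro divide_right_mono integral_Cauchy_Schwarz(2) gi ki) auto
  also have "(\<integral>y. (k y)\<^sup>2 \<partial>lborel) = c * radial_weight (DIM('a) - 1) r s"
    unfolding k_def c_def by (rule annulus_kernel_integral[OF r(1)])
  also have "sqrt ((\<integral>y. (g y)\<^sup>2 \<partial>lborel) * (c * radial_weight (DIM('a) - 1) r s)) / c
     = sqrt ((\<integral>y. (g y)\<^sup>2 \<partial>lborel) * (c * radial_weight (DIM('a) - 1) r s) / c\<^sup>2)"
    using c by (simp add: real_sqrt_divide)
  also have "\<dots> = sqrt ((\<integral>x. grad_sq f x \<partial>lborel) * radial_weight (DIM('a) - 1) r s / c)"
    using c unfolding g2 by (simp add: power2_eq_square field_simps)
  finally show ?thesis unfolding c_def .
qed

section \<open>Integrals of spherical means over radial sets\<close>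

lemma integrable_bounded_on_box:
  fixes F :: "'a::euclidean_space \<Rightarrow> 'b::euclidean_space \<Rightarrow> real"
  assumes [measurable]: "case_prod F \<in> borel_measurable (lborel \<Otimes>\<^sub>M lborel)"
    and A: "A \<in> sets lborel" "bounded A" and B: "B \<in> sets lborel" "bounded B"
    and K: "\<And>x y. \<bar>F x y\<bar> \<le> K" and supp: "\<And>x y. x \<notin> A \<or> y \<notin> B \<Longrightarrow> F x y = 0"
  shows "integrable (lborel \<Otimes>\<^sub>M lborel) (case_prod F)"
proof (rule Bochner_Integration.integrable_bound)
  have AB: "A \<times> B \<in> sets (lborel \<Otimes>\<^sub>M lborel)" using A B by simp
  have "emeasure (lborel \<Otimes>\<^sub>M lborel) (A \<times> B) = emeasure lborel A * emeasure lborel B"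
    using A B by (simp add: lborel.emeasure_pair_measure_Times)
  also have "\<dots> < \<infinity>"
    using emeasure_bounded_finite[OF A(2)] emeasure_bounded_finite[OF B(2)] by (simp add: ennreal_mult_less_top)
  finally have "integrable (lborel \<Otimes>\<^sub>M lborel) (indicator (A \<times> B) :: _ \<Rightarrow> real)"
    using AB by (intro integrable_real_indicator) auto
  then show "integrable (lborel \<Otimes>\<^sub>M lborel) (\<lambda>p. K * indicator (A \<times> B) p)" by simp
  show "AE p in lborel \<Otimes>\<^sub>M lborel. norm (case_prod F p) \<le> norm (K * indicator (A \<times> B) p)"
  proof (rule AE_I2)
    fix p :: "'a \<times> 'b"
    obtain x y where p: "p = (x, y)" by fastforce
    show "norm (case_prod F p) \<le> norm (K * indicator (A \<times> B) p)"
      using K[of x y] supp[of x y] by (cases "x \<in> A \<and> y \<in> B") (auto simp: p)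
  qed
qed simp

lemma radial_deriv_bounded:
  assumes f: "C1c f"
  obtains K where "\<And>x. \<bar>radial_deriv f x\<bar> \<le> K"
proof -
  obtain \<rho> where \<rho>: "0 < \<rho>" "\<And>x. \<rho> < norm x \<Longrightarrow> f x = 0" "\<And>x. \<rho> < norm x \<Longrightarrow> frechet_derivative f (at x) = (\<lambda>_. 0)"
    using C1c_support[OF f] by blast
  have "compact (radial_deriv f ` cball 0 \<rho>)"
    by (intro compact_continuous_image continuous_on_subset[OF radial_deriv_continuous[OF f]]) auto
  then have "bounded (radial_deriv f ` cball 0 \<rho>)" by (rule compact_imp_bounded)
  then obtain K where K: "0 < K" "\<forall>y \<in> radial_deriv f ` cball 0 \<rho>. norm y \<le> K"
    unfolding bounded_pos by (elim exE conjE)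
  have "\<bar>radial_deriv f x\<bar> \<le> K" for x
  proof (cases "norm x \<le> \<rho>")
    case True
    then show ?thesis using K(2) by auto
  next
    case False
    then show ?thesis using K(1) \<rho>(3)[of x] by (simp add: radial_deriv_def)
  qed
  then show ?thesis using that by blast
qed

text \<open>\<open>f x\<close> is recovered from the derivative along the ray through \<open>x\<close>, parametrised by
  \<open>s \<mapsto> exp (- s) *\<^sub>R x\<close>.\<close>
lemma C1c_eq_ray_integral:
  assumes f: "C1c f" and L: "0 \<le> L" "f (exp L *\<^sub>R x) = 0"
  shows "f x = - (\<integral>s. radial_deriv f (exp (- s) *\<^sub>R x) * indicator {- L..0} s \<partial>lborel)"
proof -
  define F where "F = (\<lambda>s. f (exp (- s) *\<^sub>R x))"
  have D: "(F has_real_derivative - radial_deriv f (exp (- s) *\<^sub>R x)) (at s)" for s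
  proof -
    let ?y = "exp (- s) *\<^sub>R x"
    have l: "linear (frechet_derivative f (at ?y))"
      using C1c_has_derivative[OF f] has_derivative_linear by blast
    have "((\<lambda>s. exp (- s) *\<^sub>R x) has_derivative (\<lambda>h. (- exp (- s) * h) *\<^sub>R x)) (at s)"
      by (auto intro!: derivative_eq_intros simp: mult.commute)
    from has_derivative_compose[OF this, of f] C1c_has_derivative[OF f, of ?y]
    have "(F has_derivative (\<lambda>h. frechet_derivative f (at ?y) ((- exp (- s) * h) *\<^sub>R x))) (at s)"
      unfolding F_def by blast
    also have "(\<lambda>h. frechet_derivative f (at ?y) ((- exp (- s) * h) *\<^sub>R x)) = (*) (- radial_deriv f ?y)"
      by (simp add: fun_eq_iff radial_deriv_def linear_cmul[OF l] linear_neg[OF l])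
    finally show ?thesis unfolding has_field_derivative_def .
  qed
  have c: "isCont (\<lambda>s. - radial_deriv f (exp (- s) *\<^sub>R x)) s" for s
  proof -
    have "isCont (radial_deriv f) (exp (- s) *\<^sub>R x)"
      using radial_deriv_continuous[OF f] by (simp add: continuous_on_eq_continuous_at)
    moreover have "isCont (\<lambda>s. exp (- s) *\<^sub>R x) s" by (intro continuous_intros)
    ultimately have "isCont (\<lambda>s. radial_deriv f (exp (- s) *\<^sub>R x)) s"
      using isCont_o2[of s "\<lambda>s. exp (- s) *\<^sub>R x" "radial_deriv f"] by simp
    then show ?thesis by (rule continuous_minus)
  qed
  have "(\<integral>s. - radial_deriv f (exp (- s) *\<^sub>R x) * indicator {- L..0} s \<partial>lborel) = F 0 - F (- L)"
    using L(1) D c by (intro integral_FTC_Icc_real) auto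
  then show ?thesis using L(2) by (simp add: F_def)
qed

lemma scaled_indicator_integral:
  fixes C :: "real set" and \<rho> :: real
  assumes [measurable]: "C \<in> sets borel" and C: "C \<subseteq> {a..b}" and a: "0 < a" "\<rho> < a * exp L" and "0 < \<rho>" "0 \<le> L"
  shows "\<rho> ^ DIM('a::euclidean_space) * (\<integral>s. exp s ^ DIM('a) * indicator C (exp s * \<rho>) * indicator {- L..0} s \<partial>lborel)
    = (\<integral>x. indicator C (norm (x::'a)) * indicator {..\<rho>} (norm x) \<partial>lborel) / sphere_area TYPE('a)"
proof -
  define n where "n = DIM('a) - 1"
  have n: "DIM('a) = Suc n" by (simp add: n_def)
  define g where "g = (\<lambda>s. \<rho> * exp s)"
  define h where "h = (\<lambda>t. t ^ n * indicator C t :: real)"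
  have [measurable]: "h \<in> borel_measurable borel" unfolding h_def by measurable
  have "integrable lborel (\<lambda>t. indicator {a..b} t *\<^sub>R (t ^ n))"
    by (intro borel_integrable_compact) (auto intro!: continuous_intros)
  then have hi: "integrable lborel h"
    by (rule Bochner_Integration.integrable_bound) (use C in \<open>auto simp: h_def indicator_def intro!: AE_I2\<close>)
  have "(\<integral>t. h t * indicator {g (- L)..g 0} t \<partial>lborel) = (\<integral>s. h (g s) * (\<rho> * exp s) * indicator {- L..0} s \<partial>lborel)"
  proof (rule integral_substitution(2))
    show "set_integrable lborel {g (- L)..g 0} h"
      unfolding set_integrable_def using hi by (intro integrable_mult_indicator) auto
  qed (use assms in \<open>auto simp: g_def intro!: derivative_eq_intros continuous_intros\<close>)
  also have "\<dots> = (\<integral>s. \<rho> ^ DIM('a) * (exp s ^ DIM('a) * indicator C (exp s * \<rho>) * indicator {- L..0} s) \<partial>lborel)"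
    by (simp add: h_def g_def n power_mult_distrib mult_ac)
  also have "\<dots> = \<rho> ^ DIM('a) * (\<integral>s. exp s ^ DIM('a) * indicator C (exp s * \<rho>) * indicator {- L..0} s \<partial>lborel)"
    by simp
  finally have 1: "\<rho> ^ DIM('a) * (\<integral>s. exp s ^ DIM('a) * indicator C (exp s * \<rho>) * indicator {- L..0} s \<partial>lborel)
    = (\<integral>t. h t * indicator {g (- L)..g 0} t \<partial>lborel)" ..
  have "\<rho> * exp (- L) < a" using a by (simp add: exp_minus field_simps)
  then have hg: "h t * indicator {g (- L)..g 0} t = h t * indicator {..\<rho>} t" for t
    using C by (auto simp: h_def g_def indicator_def)
  have "(\<integral>x. indicator C (norm (x::'a)) * indicator {..\<rho>} (norm x) \<partial>lborel)
      = (\<integral>t. indicator {0..} t * (sphere_area TYPE('a) * t ^ (DIM('a) - 1)) * (indicator C t * indicator {..\<rho>} t) \<partial>lborel)"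
    by (rule integral_norm_lborel) measurable
  also have "\<dots> = (\<integral>t. sphere_area TYPE('a) * (h t * indicator {..\<rho>} t) \<partial>lborel)"
    using C a(1) by (intro Bochner_Integration.integral_cong) (auto simp: h_def n_def indicator_def)
  also have "\<dots> = sphere_area TYPE('a) * (\<integral>t. h t * indicator {..\<rho>} t \<partial>lborel)"
    by simp
  finally show ?thesis
    using sphere_area_pos[where 'a = 'a] unfolding 1 hg by simp
qed

lemma
  fixes f :: "'a::euclidean_space \<Rightarrow> real"
  assumes f: "C1c f" and Cm[measurable]: "C \<in> sets borel" and C: "C \<subseteq> {a..b}" and a: "0 < a"
  shows integral_sph_mean:
      "(\<integral>x. indicator C (norm x) * f x \<partial>lborel) = (\<integral>x. indicator C (norm (x::'a)) * sph_mean f (norm x) \<partial>lborel)"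
    and integrable_sph_mean: "integrable lborel (\<lambda>x::'a. indicator C (norm x) * sph_mean f (norm x))"
proof -
  define D where "D = radial_deriv f"
  define c where "c = sphere_area TYPE('a)"
  have c: "0 < c" unfolding c_def by (rule sphere_area_pos)
  obtain \<rho> where \<rho>: "0 < \<rho>" "\<And>x. \<rho> < norm x \<Longrightarrow> f x = 0" "\<And>x. \<rho> < norm x \<Longrightarrow> frechet_derivative f (at x) = (\<lambda>_. 0)"
    using C1c_support[OF f] by blast
  have D0: "D x = 0" if "\<rho> < norm x" for x using \<rho>(3)[OF that] by (simp add: D_def radial_deriv_def)
  have D00: "D 0 = 0" using radial_deriv_eq_sum[OF f, of 0] by (simp add: D_def)
  obtain K where K: "\<And>x. \<bar>D x\<bar> \<le> K" unfolding D_def using radial_deriv_bounded[OF f] by blast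
  have K0: "0 \<le> K" using K[of 0] by linarith
  have [measurable]: "D \<in> borel_measurable borel"
    unfolding D_def using radial_deriv_continuous[OF f] by (rule borel_measurable_continuous_onI)
  define L where "L = \<rho> / a"
  have L: "0 \<le> L" using \<rho>(1) a by (simp add: L_def)
  have "a * (1 + L) \<le> a * exp L" using exp_ge_add_one_self[of L] a by (intro mult_left_mono) auto
  then have aL: "\<rho> < a * exp L" using a by (simp add: L_def distrib_left)
  define A where "A = {x::'a. norm x \<in> C}"
  have A: "A \<in> sets lborel" "bounded A"
  proof -
    show "A \<in> sets lborel" unfolding A_def by measurable
    have "A \<subseteq> cball 0 b" using C by (auto simp: A_def)
    then show "bounded A" by (rule bounded_subset[OF bounded_cball])
  qed
  have ball: "cball (0::'a) \<rho> \<in> sets lborel" "bounded (cball (0::'a) \<rho>)" by auto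
  have ivl: "{- L..0} \<in> sets lborel" "bounded {- L..0}" by auto
  define m where "m = (\<lambda>t. \<integral>x. indicator C (norm (x::'a)) * indicator {..t} (norm x) \<partial>lborel :: real)"

  define F1 where "F1 = (\<lambda>x s. indicator C (norm x) * (D (exp (- s) *\<^sub>R x) * indicator {- L..0} s) :: real)"
  have F1: "integrable (lborel \<Otimes>\<^sub>M lborel) (case_prod F1)"
  proof (rule integrable_bounded_on_box[OF _ A ivl])
    show "case_prod F1 \<in> borel_measurable (lborel \<Otimes>\<^sub>M lborel)" unfolding F1_def by measurable
    show "\<bar>F1 x s\<bar> \<le> K" for x s using K[of "exp (- s) *\<^sub>R x"] K0 by (auto simp: F1_def indicator_def)
    show "F1 x s = 0" if "x \<notin> A \<or> s \<notin> {- L..0}" for x s using that by (auto simp: F1_def A_def)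
  qed
  define F2 where "F2 = (\<lambda>s y. D y * (exp s ^ DIM('a) * indicator C (exp s * norm y) * indicator {- L..0} s) :: real)"
  have F2: "integrable (lborel \<Otimes>\<^sub>M lborel) (case_prod F2)"
  proof (rule integrable_bounded_on_box[OF _ ivl ball])
    show "case_prod F2 \<in> borel_measurable (lborel \<Otimes>\<^sub>M lborel)" unfolding F2_def by measurable
    show "\<bar>F2 s y\<bar> \<le> K" for s y
    proof (cases "s \<in> {- L..0}")
      case True
      then have "exp s ^ DIM('a) \<le> 1" by (intro power_le_one) auto
      then have "exp s ^ DIM('a) * indicator C (exp s * norm y) \<le> (1::real)"
        by (auto simp: indicator_def)
      then have "\<bar>D y\<bar> * (exp s ^ DIM('a) * indicator C (exp s * norm y)) \<le> K * 1"
        using K[of y] K0 by (intro mult_mono) auto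
      then show ?thesis using True by (simp add: F2_def abs_mult)
    qed (simp add: F2_def K0)
    show "F2 s y = 0" if "s \<notin> {- L..0} \<or> y \<notin> cball 0 \<rho>" for s y using that D0[of y] by (auto simp: F2_def)
  qed
  define F3 where "F3 = (\<lambda>x y. indicator C (norm x) * (indicator {y::'a. norm (x::'a) \<le> norm y} y * (D y / norm y ^ DIM('a))) :: real)"
  have F3: "integrable (lborel \<Otimes>\<^sub>M lborel) (case_prod F3)"
  proof (rule integrable_bounded_on_box[OF _ A ball])
    have "(\<lambda>(x, y). indicator C (norm x) * (if norm x \<le> norm y then D y / norm y ^ DIM('a) else 0))
       \<in> borel_measurable (lborel \<Otimes>\<^sub>M lborel)" by measurable
    also have "(\<lambda>(x, y). indicator C (norm x) * (if norm x \<le> norm y then D y / norm y ^ DIM('a) else 0)) = case_prod F3"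
      by (auto simp: F3_def fun_eq_iff)
    finally show "case_prod F3 \<in> borel_measurable (lborel \<Otimes>\<^sub>M lborel)" .
    show "\<bar>F3 x y\<bar> \<le> K / a ^ DIM('a)" for x y
    proof (cases "norm x \<in> C \<and> norm x \<le> norm y")
      case True
      then have "a \<le> norm y" using C by force
      from divide_power_le[OF a this, of "D y" "DIM('a)"]
      have "\<bar>F3 x y\<bar> \<le> \<bar>D y\<bar> / a ^ DIM('a)" using True a by (simp add: F3_def)
      also have "\<dots> \<le> K / a ^ DIM('a)" using K[of y] a by (intro divide_right_mono) auto
      finally show ?thesis .
    qed (use K0 a in \<open>auto simp: F3_def\<close>)
    show "F3 x y = 0" if "x \<notin> A \<or> y \<notin> cball 0 \<rho>" for x y using that D0[of y] by (auto simp: F3_def A_def)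
  qed

  have 1: "indicator C (norm x) * f x = - (\<integral>s. F1 x s \<partial>lborel)" for x
  proof (cases "norm x \<in> C")
    case True
    then have "a * exp L \<le> norm x * exp L" using C by (intro mult_right_mono) auto
    then have "\<rho> < norm x * exp L" using aL by linarith
    then have "f (exp L *\<^sub>R x) = 0" by (intro \<rho>(2)) (simp add: mult.commute)
    from C1c_eq_ray_integral[OF f L this] True show ?thesis by (simp add: F1_def D_def)
  qed (simp add: F1_def)
  have 3: "(\<integral>x. F1 x s \<partial>lborel) = (\<integral>y. F2 s y \<partial>lborel)" for s
  proof -
    define g where "g = (\<lambda>y. indicator C (exp s * norm y) * D y :: real)"
    have [measurable]: "g \<in> borel_measurable borel" unfolding g_def by measurable
    have es: "exp s * exp (- s) = 1" by (simp add: exp_minus)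
    have gx: "g (exp (- s) *\<^sub>R x) = indicator C (norm x) * D (exp (- s) *\<^sub>R x)" for x
      by (simp add: g_def mult.assoc[symmetric] es)
    have "(\<integral>y. F2 s y \<partial>lborel) = (\<integral>y. exp s ^ DIM('a) * indicator {- L..0} s * g y \<partial>lborel)"
      by (simp add: F2_def g_def mult_ac)
    also have "\<dots> = exp s ^ DIM('a) * indicator {- L..0} s * (\<integral>y. g y \<partial>lborel)" by (rule integral_mult_right_zero)
    also have "\<dots> = (exp s * exp (- s)) ^ DIM('a) * indicator {- L..0} s * (\<integral>x. g (exp (- s) *\<^sub>R x) \<partial>lborel)"
      by (subst integral_lborel_scale[of g "exp (- s)"]) (simp_all add: power_mult_distrib)
    also have "\<dots> = indicator {- L..0} s * (\<integral>x. g (exp (- s) *\<^sub>R x) \<partial>lborel)" unfolding es by simp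
    also have "\<dots> = (\<integral>x. indicator {- L..0} s * g (exp (- s) *\<^sub>R x) \<partial>lborel)" by (rule integral_mult_right_zero[symmetric])
    also have "\<dots> = (\<integral>x. F1 x s \<partial>lborel)" unfolding gx by (simp add: F1_def mult_ac)
    finally show ?thesis ..
  qed
  have 5: "(\<integral>s. F2 s y \<partial>lborel) = (\<integral>x. F3 x y \<partial>lborel) / c" for y
  proof (cases "y = 0 \<or> \<rho> < norm y")
    case True
    then have "D y = 0" using D0 D00 by auto
    then show ?thesis by (simp add: F2_def F3_def)
  next
    case False
    then have y: "0 < norm y" "norm y < a * exp L" using aL by auto
    have "(\<integral>s. F2 s y \<partial>lborel) = D y * (\<integral>s. exp s ^ DIM('a) * indicator C (exp s * norm y) * indicator {- L..0} s \<partial>lborel)"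
      unfolding F2_def by (rule integral_mult_right_zero)
    also have "\<dots> = D y / norm y ^ DIM('a) * (norm y ^ DIM('a) * (\<integral>s. exp s ^ DIM('a) * indicator C (exp s * norm y) * indicator {- L..0} s \<partial>lborel))"
      using y by simp
    also have "\<dots> = D y / norm y ^ DIM('a) * (m (norm y) / c)"
      unfolding scaled_indicator_integral[where 'a = 'a, OF Cm C a y(2,1) L] m_def c_def ..
    also have "\<dots> = (D y / norm y ^ DIM('a) * m (norm y)) / c" by simp
    also have "D y / norm y ^ DIM('a) * m (norm y) = (\<integral>x. D y / norm y ^ DIM('a) * (indicator C (norm (x::'a)) * indicator {..norm y} (norm x)) \<partial>lborel)"
      unfolding m_def by (rule integral_mult_right_zero[symmetric])
    also have "\<dots> = (\<integral>x. F3 x y \<partial>lborel)"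
      by (intro Bochner_Integration.integral_cong) (auto simp: F3_def indicator_def)
    finally show ?thesis .
  qed
  have 6: "indicator C (norm x) * sph_mean f (norm x) = - (\<integral>y. F3 x y \<partial>lborel) / c" for x :: 'a
    unfolding F3_def sph_mean_def D_def c_def integral_mult_right_zero by simp

  have "(\<integral>x. indicator C (norm x) * f x \<partial>lborel) = - (\<integral>x. \<integral>s. F1 x s \<partial>lborel \<partial>lborel)"
    unfolding 1 by simp
  also have "\<dots> = - (\<integral>s. \<integral>x. F1 x s \<partial>lborel \<partial>lborel)"
    by (simp only: lborel_pair.Fubini_integral[OF F1])
  also have "\<dots> = - (\<integral>s. \<integral>y. F2 s y \<partial>lborel \<partial>lborel)" unfolding 3 ..
  also have "\<dots> = - (\<integral>y. \<integral>s. F2 s y \<partial>lborel \<partial>lborel)"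
    by (simp only: lborel_pair.Fubini_integral[OF F2])
  also have "\<dots> = - (\<integral>y. \<integral>x. F3 x y \<partial>lborel \<partial>lborel) / c" unfolding 5 by simp
  also have "\<dots> = - (\<integral>x. \<integral>y. F3 x y \<partial>lborel \<partial>lborel) / c"
    by (simp only: lborel_pair.Fubini_integral[OF F3])
  also have "\<dots> = (\<integral>x. indicator C (norm (x::'a)) * sph_mean f (norm x) \<partial>lborel)" unfolding 6 by simp
  finally show "(\<integral>x. indicator C (norm x) * f x \<partial>lborel) = (\<integral>x. indicator C (norm (x::'a)) * sph_mean f (norm x) \<partial>lborel)" .
  show "integrable lborel (\<lambda>x::'a. indicator C (norm x) * sph_mean f (norm x))"
    unfolding 6 using lborel_pair.integrable_fst[OF F3] by simp
qed

section \<open>The radial envelope\<close>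

lemma radial_weight_mono:
  assumes "0 < r" "s \<le> s'"
  shows "radial_weight n r s \<le> radial_weight n r s'"
  unfolding radial_weight_def
  by (intro integral_mono radial_weight_integrable assms) (use assms in \<open>auto simp: indicator_def\<close>)

lemma sph_mean_abs_le:
  fixes f :: "'a::euclidean_space \<Rightarrow> real"
  assumes f: "C1c f" and r: "0 < r"
  defines "n \<equiv> DIM('a) - 1" and "c \<equiv> sphere_area TYPE('a)"
  shows "\<bar>sph_mean f r\<bar> \<le> sqrt ((\<integral>x. grad_sq f x \<partial>lborel) * radial_weight n r (r + 2) / c)
     + sqrt ((\<integral>x. (f x)\<^sup>2 \<partial>lborel) / (c * (r + 1) ^ n))"
proof -
  define C where "C = {r + 1..<r + 2}"
  have C[measurable]: "C \<in> sets borel" and C: "C \<in> sets borel" "C \<subseteq> {r + 1..r + 2}" "0 < r + 1" using r by (auto simp: C_def)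
  have c: "0 < c" unfolding c_def by (rule sphere_area_pos)
  define i where "i = (\<lambda>x::'a. indicator C (norm x) :: real)"
  have [measurable]: "i \<in> borel_measurable borel" unfolding i_def using C(1) by measurable
  have i2: "(i x)\<^sup>2 = i x" for x by (simp add: i_def indicator_def)
  have i0: "0 \<le> i x" for x by (simp add: i_def)
  have im: "i = indicator {x. norm x \<in> C}" by (auto simp: i_def indicator_def fun_eq_iff)
  have ii: "integrable lborel i"
  proof -
    have "bounded {x::'a. norm x \<in> C}"
      by (rule bounded_subset[OF bounded_cball[of 0 "r + 2"]]) (auto simp: C_def)
    moreover have "{x::'a. norm x \<in> C} \<in> sets lborel" by measurable
    ultimately show ?thesis unfolding im
      by (intro integrable_real_indicator emeasure_bounded_finite)
  qed
  define m where "m = (\<integral>x. i x \<partial>lborel)"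
  define E where "E = sqrt ((\<integral>x. grad_sq f x \<partial>lborel) * radial_weight n r (r + 2) / c)"
  define l where "l = (\<integral>x. (f x)\<^sup>2 \<partial>lborel)"
  have l0: "0 \<le> l" unfolding l_def by simp
  have m: "c * (r + 1) ^ n \<le> m"
  proof -
    have "integrable lborel (\<lambda>t. (c * (r + 1) ^ n) * indicator C t)"
      unfolding C_def by (intro integrable_mult_right integrable_real_indicator) auto
    moreover have "integrable lborel (\<lambda>s. indicator {0..} s * (c * s ^ n) * indicator C s)"
      using ii integrable_norm_lborel_iff[where 'a = 'a and h = "indicator C"] C(1)
      unfolding i_def c_def n_def by simp
    moreover have "(c * (r + 1) ^ n) * indicator C t \<le> indicator {0..} t * (c * t ^ n) * indicator C t" for t
      using r c by (auto simp: C_def indicator_def intro!: mult_left_mono power_mono)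
    ultimately have "(\<integral>t. (c * (r + 1) ^ n) * indicator C t \<partial>lborel) \<le> (\<integral>t. indicator {0..} t * (c * t ^ n) * indicator C t \<partial>lborel)"
      by (rule integral_mono)
    also have "\<dots> = m" unfolding m_def i_def c_def n_def
      using C(1) by (intro integral_norm_lborel[symmetric]) simp
    also have "(\<integral>t. (c * (r + 1) ^ n) * indicator C t \<partial>lborel) = c * (r + 1) ^ n" by (simp add: C_def)
    finally show ?thesis .
  qed
  have cr: "0 < c * (r + 1) ^ n" using c r by simp
  have m0: "0 < m" using m cr by linarith
  have si: "integrable lborel (\<lambda>x. i x * sph_mean f (norm x))"
    unfolding i_def using C by (intro integrable_sph_mean f)
  have "m * sph_mean f r = (\<integral>x. i x * sph_mean f r \<partial>lborel)" unfolding m_def using ii by simp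
  also have "\<dots> = (\<integral>x. i x * (sph_mean f r - sph_mean f (norm x)) + i x * sph_mean f (norm x) \<partial>lborel)"
    by (simp add: algebra_simps)
  also have "\<dots> = (\<integral>x. i x * (sph_mean f r - sph_mean f (norm x)) \<partial>lborel) + (\<integral>x. i x * sph_mean f (norm x) \<partial>lborel)"
    using ii si by (intro Bochner_Integration.integral_add) (auto simp: right_diff_distrib)
  also have "(\<integral>x. i x * sph_mean f (norm x) \<partial>lborel) = (\<integral>x. i x * f x \<partial>lborel)"
    unfolding i_def using C by (intro integral_sph_mean[symmetric] f)
  finally have eq: "m * sph_mean f r = (\<integral>x. i x * (sph_mean f r - sph_mean f (norm x)) \<partial>lborel) + (\<integral>x. i x * f x \<partial>lborel)" .
  have "\<bar>\<integral>x. i x * (sph_mean f r - sph_mean f (norm x)) \<partial>lborel\<bar> \<le> (\<integral>x. \<bar>i x * (sph_mean f r - sph_mean f (norm x))\<bar> \<partial>lborel)"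
    by (rule integral_abs_bound)
  also have "\<dots> \<le> (\<integral>x. i x * E \<partial>lborel)"
  proof (rule integral_mono')
    show "integrable lborel (\<lambda>x. i x * E)" using ii by simp
    have dE: "\<bar>sph_mean f r - sph_mean f (norm x)\<bar> \<le> E" if "norm x \<in> C" for x :: 'a
    proof -
      have x: "r \<le> norm x" "norm x \<le> r + 2" using that by (auto simp: C_def)
      have "0 \<le> (\<integral>x. grad_sq f x \<partial>lborel)" by (simp add: grad_sq_nonneg)
      then have "(\<integral>x. grad_sq f x \<partial>lborel) * radial_weight n r (norm x) / c \<le> (\<integral>x. grad_sq f x \<partial>lborel) * radial_weight n r (r + 2) / c"
        using c radial_weight_mono[OF r x(2), of n] by (intro divide_right_mono mult_left_mono) auto
      then have "sqrt ((\<integral>x. grad_sq f x \<partial>lborel) * radial_weight n r (norm x) / c) \<le> E"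
        unfolding E_def by (rule real_sqrt_le_mono)
      then show ?thesis using sph_mean_dist_le[OF f r x(1)] unfolding n_def c_def by linarith
    qed
    show "\<bar>i x * (sph_mean f r - sph_mean f (norm x))\<bar> \<le> i x * E" for x
      using dE[of x] by (cases "norm x \<in> C") (auto simp: i_def)
    have "0 \<le> E" unfolding E_def
      using c radial_weight_nonneg[OF r, of n "r + 2"] by (simp add: grad_sq_nonneg)
    then show "0 \<le> i x * E" for x using i0[of x] by simp
  qed
  also have "\<dots> = m * E" unfolding m_def using ii by simp
  finally have b1: "\<bar>\<integral>x. i x * (sph_mean f r - sph_mean f (norm x)) \<partial>lborel\<bar> \<le> m * E" .
  have "\<bar>\<integral>x. i x * f x \<partial>lborel\<bar> \<le> (\<integral>x. \<bar>i x * f x\<bar> \<partial>lborel)" by (rule integral_abs_bound)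
  also have "\<dots> \<le> sqrt ((\<integral>x. (i x)\<^sup>2 \<partial>lborel) * (\<integral>x. (f x)\<^sup>2 \<partial>lborel))"
    using C1c_borel[OF f] C1c_integrable_power2[OF f] ii by (intro integral_Cauchy_Schwarz(2)) (auto simp: i2)
  also have "\<dots> = sqrt (m * l)" unfolding i2 m_def l_def ..
  also have "\<dots> = m * sqrt (l / m)"
  proof -
    have "m * l = m\<^sup>2 * (l / m)" using m0 by (simp add: power2_eq_square)
    then show ?thesis using m0 by (simp only: real_sqrt_mult real_sqrt_abs abs_of_pos)
  qed
  also have "\<dots> \<le> m * sqrt (l / (c * (r + 1) ^ n))"
    by (rule mult_left_mono[OF real_sqrt_le_mono[OF divide_left_mono[OF m l0 mult_pos_pos[OF m0 cr]]] less_imp_le[OF m0]])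
  finally have b2: "\<bar>\<integral>x. i x * f x \<partial>lborel\<bar> \<le> m * sqrt (l / (c * (r + 1) ^ n))" .
  have "m * \<bar>sph_mean f r\<bar> = \<bar>m * sph_mean f r\<bar>" using m0 by (simp add: abs_mult)
  also have "\<dots> \<le> m * (E + sqrt (l / (c * (r + 1) ^ n)))"
    unfolding eq distrib_left using b1 b2 by linarith
  finally show ?thesis using m0 unfolding E_def l_def by simp
qed

lemma radial_weight_le_powr:
  assumes \<alpha>: "0 < \<alpha>" "real n - 1 \<le> 2 * \<alpha>" and r: "0 < r" "r \<le> 1"
  shows "radial_weight n r (r + 2) \<le> 3 powr (2 * \<alpha> + 1 - real n) / (2 * \<alpha>) * r powr (- 2 * \<alpha>)"
proof -
  define K where "K = 3 powr (2 * \<alpha> + 1 - real n)"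
  have K: "0 < K" by (simp add: K_def)
  define F where "F = (\<lambda>t::real. - (K / (2 * \<alpha>)) * t powr (- 2 * \<alpha>))"
  define g where "g = (\<lambda>t::real. K * t powr (- 2 * \<alpha> - 1))"
  have FTC: "has_bochner_integral lborel (\<lambda>t. g t * indicator {r..r + 2} t) (F (r + 2) - F r)"
  proof (rule has_bochner_integral_FTC_Icc_real)
    fix t assume t: "r \<le> t" "t \<le> r + 2"
    then have t0: "0 < t" using r by linarith
    show "(F has_real_derivative g t) (at t)"
      unfolding F_def g_def using t0 \<alpha>
      by (auto intro!: derivative_eq_intros simp: powr_diff)
    show "isCont g t" unfolding g_def using t0 by (intro continuous_intros) auto
  qed (use r in simp)
  have "radial_weight n r (r + 2) \<le> (\<integral>t. g t * indicator {r..r + 2} t \<partial>lborel)"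
    unfolding radial_weight_def
  proof (rule integral_mono)
    show "integrable lborel (\<lambda>t. g t * indicator {r..r + 2} t)" using FTC by (rule integrable.intros)
    show "indicator {r..<r + 2} t / t ^ n \<le> g t * indicator {r..r + 2} t" for t
    proof (cases "t \<in> {r..<r + 2}")
      case True
      then have t: "0 < t" "t \<le> 3" using r by auto
      have "1 / t ^ n = t powr (- real n)" using t by (simp add: powr_minus powr_realpow divide_inverse)
      also have "\<dots> = t powr (2 * \<alpha> + 1 - real n) * t powr (- 2 * \<alpha> - 1)"
        by (simp add: powr_add[symmetric])
      also have "\<dots> \<le> K * t powr (- 2 * \<alpha> - 1)"
        unfolding K_def using t \<alpha> by (intro mult_right_mono powr_mono2) auto
      finally show ?thesis using True by (simp add: g_def)
    qed (use r K in \<open>auto simp: g_def indicator_def\<close>)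
  qed (use radial_weight_integrable r in auto)
  also have "\<dots> = F (r + 2) - F r" using FTC by (rule has_bochner_integral_integral_eq)
  also have "\<dots> \<le> K / (2 * \<alpha>) * r powr (- 2 * \<alpha>)" unfolding F_def using K \<alpha> by simp
  finally show ?thesis unfolding K_def .
qed

definition envelope :: "nat \<Rightarrow> real \<Rightarrow> real \<Rightarrow> real" where
  "envelope n \<alpha> r = (if r \<le> 1 then r powr (- \<alpha>) else r powr (- real n / 2))"

lemma envelope_nonneg: "0 \<le> envelope n \<alpha> r"
  by (simp add: envelope_def)

lemma envelope_borel [measurable]: "envelope n \<alpha> \<in> borel_measurable borel"
  unfolding envelope_def[abs_def] by measurable

lemma sph_mean_envelope:
  fixes \<alpha> :: real
  assumes \<alpha>: "0 < \<alpha>" "real DIM('a::euclidean_space) - 2 \<le> 2 * \<alpha>"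
  obtains B where "0 < B"
    "\<And>(f::'a \<Rightarrow> real) H r. C1c f \<Longrightarrow> (\<integral>x. grad_sq f x \<partial>lborel) \<le> H\<^sup>2 \<Longrightarrow> (\<integral>x. (f x)\<^sup>2 \<partial>lborel) \<le> H\<^sup>2 \<Longrightarrow>
      0 \<le> H \<Longrightarrow> 0 < r \<Longrightarrow> \<bar>sph_mean f r\<bar> \<le> B * H * envelope (DIM('a) - 1) \<alpha> r"
proof -
  define n where "n = DIM('a) - 1"
  have n: "real n = real DIM('a) - 1" by (simp add: n_def of_nat_diff)
  define c where "c = sphere_area TYPE('a)"
  have c: "0 < c" unfolding c_def by (rule sphere_area_pos)
  define K where "K = max 2 (3 powr (2 * \<alpha> + 1 - real n) / (2 * \<alpha>))"
  have K: "0 < K" by (simp add: K_def)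
  define B where "B = sqrt (K / c) + sqrt (1 / c)"
  have "0 < B" using K c by (simp add: B_def add_pos_pos)
  moreover have "\<bar>sph_mean f r\<bar> \<le> B * H * envelope n \<alpha> r"
    if f: "C1c f" and G: "(\<integral>x. grad_sq f x \<partial>lborel) \<le> H\<^sup>2" and l: "(\<integral>x. (f x)\<^sup>2 \<partial>lborel) \<le> H\<^sup>2"
      and H: "0 \<le> H" and r: "0 < r" for f :: "'a \<Rightarrow> real" and H r
  proof -
    let ?e = "envelope n \<alpha> r"
    have e0: "0 \<le> ?e" by (rule envelope_nonneg)
    have e2: "?e\<^sup>2 = (if r \<le> 1 then r powr (- 2 * \<alpha>) else 1 / r ^ n)"
    proof -
      have "(r powr x)\<^sup>2 = r powr (2 * x)" for x
        by (simp add: power2_eq_square powr_add[symmetric])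
      moreover have "r powr (- real n) = 1 / r ^ n"
        using r by (simp add: powr_minus powr_realpow divide_inverse)
      ultimately show ?thesis by (simp add: envelope_def)
    qed
    have w: "radial_weight n r (r + 2) \<le> K * ?e\<^sup>2"
    proof (cases "r \<le> 1")
      case True
      have "radial_weight n r (r + 2) \<le> 3 powr (2 * \<alpha> + 1 - real n) / (2 * \<alpha>) * r powr (- 2 * \<alpha>)"
        using \<alpha> n r True by (intro radial_weight_le_powr) auto
      also have "\<dots> \<le> K * r powr (- 2 * \<alpha>)" by (intro mult_right_mono) (auto simp: K_def)
      finally show ?thesis using True by (simp add: e2)
    next
      case False
      have "radial_weight n r (r + 2) \<le> 2 / r ^ n" using radial_weight_le[OF r, of "r + 2" n] by simp
      also have "\<dots> \<le> K * (1 / r ^ n)" using r by (simp add: K_def divide_right_mono)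
      finally show ?thesis using False by (simp add: e2)
    qed
    have v: "1 / (r + 1) ^ n \<le> ?e\<^sup>2"
    proof (cases "r \<le> 1")
      case True
      have "1 / (r + 1) ^ n \<le> 1" using r by simp
      also have "1 \<le> r powr (- 2 * \<alpha>)" using r True \<alpha> by (simp add: powr_minus one_le_inverse powr_le1)
      finally show ?thesis using True by (simp add: e2)
    next
      case False
      then show ?thesis using r by (auto simp: e2 intro!: divide_left_mono power_mono)
    qed
    have "(\<integral>x. grad_sq f x \<partial>lborel) * radial_weight n r (r + 2) / c \<le> H\<^sup>2 * (K * ?e\<^sup>2) / c"
      using G w c radial_weight_nonneg[OF r, of n "r + 2"] by (intro divide_right_mono mult_mono) auto
    also have "\<dots> = (sqrt (K / c) * (H * ?e))\<^sup>2" using K c by (simp add: power_mult_distrib)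
    finally have 1: "sqrt ((\<integral>x. grad_sq f x \<partial>lborel) * radial_weight n r (r + 2) / c) \<le> sqrt (K / c) * (H * ?e)"
      using K c H e0 by (intro real_le_lsqrt) auto
    have "(\<integral>x. (f x)\<^sup>2 \<partial>lborel) / (c * (r + 1) ^ n) = (\<integral>x. (f x)\<^sup>2 \<partial>lborel) * (1 / (r + 1) ^ n) / c"
      by simp
    also have "\<dots> \<le> H\<^sup>2 * ?e\<^sup>2 / c" using l v c r by (intro divide_right_mono mult_mono) auto
    also have "\<dots> = (sqrt (1 / c) * (H * ?e))\<^sup>2" using c by (simp add: power_mult_distrib power_divide)
    finally have 2: "sqrt ((\<integral>x. (f x)\<^sup>2 \<partial>lborel) / (c * (r + 1) ^ n)) \<le> sqrt (1 / c) * (H * ?e)"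
      using c H e0 by (intro real_le_lsqrt) auto
    have "\<bar>sph_mean f r\<bar> \<le> sqrt (K / c) * (H * ?e) + sqrt (1 / c) * (H * ?e)"
      using sph_mean_abs_le[OF f r] 1 2 unfolding n_def c_def by linarith
    then show ?thesis by (simp add: B_def algebra_simps)
  qed
  ultimately show ?thesis using that unfolding n_def by blast
qed

section \<open>Radial profiles\<close>

lemma radial_pos_null:
  fixes w :: "'a::euclidean_space \<Rightarrow> real"
  assumes rad: "radial w" and wm[measurable]: "w \<in> borel_measurable lebesgue"
    and int: "\<And>C. compact C \<Longrightarrow> C \<subseteq> {0<..} \<Longrightarrow> integrable lebesgue (\<lambda>x. indicator C (norm x) * w x)"
    and zero: "\<And>C. compact C \<Longrightarrow> C \<subseteq> {0<..} \<Longrightarrow> (\<integral>x. indicator C (norm x) * w x \<partial>lebesgue) = 0"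
  shows "{x. x \<noteq> 0 \<and> 0 < w x} \<in> null_sets lebesgue"
proof -
  define S where "S = {x. x \<noteq> 0 \<and> 0 < w x}"
  have "{0::'a} \<in> sets lebesgue" by (intro sets_completionI_sets) auto
  moreover have "{x \<in> space lebesgue. 0 < w x} \<in> sets lebesgue" by measurable
  ultimately have "{x \<in> space lebesgue. 0 < w x} - {0} \<in> sets lebesgue" by (rule sets.Diff[rotated])
  also have "{x \<in> space lebesgue. 0 < w x} - {0} = S" by (auto simp: S_def)
  finally have S: "S \<in> sets lebesgue" .
  have null: "K \<in> null_sets lebesgue" if K: "compact K" "K \<subseteq> S" for K
  proof -
    define C where "C = norm ` K"
    have C: "compact C" "C \<subseteq> {0<..}"
      unfolding C_def using K by (auto intro!: compact_continuous_image continuous_intros simp: S_def)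
    have pos: "0 < w x" if x: "norm x \<in> C" for x
    proof -
      obtain k where k: "k \<in> K" "norm x = norm k" using x unfolding C_def by blast
      have "w x = w k" using rad k(2) unfolding radial_def by blast
      then show ?thesis using k(1) K(2) by (auto simp: S_def)
    qed
    have nn: "AE x in lebesgue. 0 \<le> indicator C (norm x) * w x"
      using pos by (intro AE_I2) (auto simp: indicator_def less_imp_le)
    have "AE x in lebesgue. indicator C (norm x) * w x = 0"
      using integral_nonneg_eq_0_iff_AE[OF int[OF C] nn] zero[OF C] by simp
    moreover have "x \<notin> K" if "indicator C (norm x) * w x = 0" for x
    proof
      assume "x \<in> K"
      then have "norm x \<in> C" by (simp add: C_def)
      with pos[OF this] that show False by simp
    qed
    ultimately have "AE x in lebesgue. x \<notin> K" by (elim AE_mp) (auto intro!: AE_I2)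
    moreover have "K \<in> sets lebesgue" using K(1) by (simp add: borel_compact)
    ultimately show ?thesis by (simp add: AE_iff_null_sets)
  qed
  have "emeasure lebesgue S \<le> 0 + ennreal e" if e: "0 < e" for e
  proof -
    obtain T where T: "closed T" "T \<subseteq> S" "S - T \<in> lmeasurable" "emeasure lebesgue (S - T) < ennreal e"
      using sets_lebesgue_inner_closed[OF S e] by blast
    have "(\<Union>n. T \<inter> cball 0 (real n)) \<in> null_sets lebesgue"
      using T by (intro null_sets_UN null) (auto intro: closed_Int_compact)
    also have "(\<Union>n. T \<inter> cball 0 (real n)) = T" using real_arch_simple by auto
    finally have T0: "T \<in> null_sets lebesgue" .
    have "emeasure lebesgue S = emeasure lebesgue (T \<union> (S - T))" using T(2) by (simp add: Un_absorb1)
    also have "\<dots> \<le> emeasure lebesgue T + emeasure lebesgue (S - T)"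
      using T T0 by (intro emeasure_subadditive) auto
    also have "\<dots> \<le> 0 + ennreal e" using null_setsD1[OF T0] T(4) by (simp add: less_imp_le)
    finally show ?thesis .
  qed
  then have "emeasure lebesgue S \<le> 0" by (rule ennreal_le_epsilon)
  with S show ?thesis unfolding S_def[symmetric] by (simp add: null_sets_def)
qed

lemma radial_AE_zero:
  fixes w :: "'a::euclidean_space \<Rightarrow> real"
  assumes rad: "radial w" and wm: "w \<in> borel_measurable lebesgue"
    and int: "\<And>C. compact C \<Longrightarrow> C \<subseteq> {0<..} \<Longrightarrow> integrable lebesgue (\<lambda>x. indicator C (norm x) * w x)"
    and zero: "\<And>C. compact C \<Longrightarrow> C \<subseteq> {0<..} \<Longrightarrow> (\<integral>x. indicator C (norm x) * w x \<partial>lebesgue) = 0"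
  shows "AE x in lebesgue. w x = 0"
proof -
  have 1: "{x. x \<noteq> 0 \<and> 0 < w x} \<in> null_sets lebesgue" by (rule radial_pos_null[OF assms])
  have "radial (\<lambda>x. - w x)" using rad unfolding radial_def by metis
  then have 2: "{x. x \<noteq> 0 \<and> 0 < - w x} \<in> null_sets lebesgue"
    by (rule radial_pos_null) (use wm int zero in auto)
  have 3: "{0::'a} \<in> null_sets lebesgue" by (simp add: null_sets_completion_iff)
  have "{x. x \<noteq> 0 \<and> 0 < w x} \<union> {x. x \<noteq> 0 \<and> 0 < - w x} \<union> {0} \<in> null_sets lebesgue"
    using 1 2 3 by (intro null_sets.Un)
  then show ?thesis by (rule AE_I') auto
qed

lemma envelope_le:
  assumes "0 < a" "a \<le> r" "0 \<le> \<alpha>"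
  shows "envelope n \<alpha> r \<le> 1 + a powr (- \<alpha>)"
proof (cases "r \<le> 1")
  case True
  have "r powr (- \<alpha>) \<le> a powr (- \<alpha>)" using assms by (intro powr_mono2') auto
  then show ?thesis using True by (simp add: envelope_def)
next
  case False
  have "r powr (- real n / 2) \<le> r powr 0" using False by (intro powr_mono) auto
  also have "\<dots> \<le> 1 + a powr (- \<alpha>)" using False by simp
  finally show ?thesis using False by (simp add: envelope_def)
qed

lemma normV_sq_bounds:
  fixes f :: "'a::euclidean_space \<Rightarrow> real"
  assumes f: "C1c f" and V: "\<And>x. c0 \<le> V x" "0 < c0" and b: "normV_sq V f \<le> ennreal e" "0 \<le> e"
  shows "(\<integral>x. grad_sq f x \<partial>lborel) \<le> max 1 (1 / c0) * e" "(\<integral>x. (f x)\<^sup>2 \<partial>lborel) \<le> max 1 (1 / c0) * e"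
    "(\<integral>\<^sup>+x. ennreal (V x * (f x)\<^sup>2) \<partial>lebesgue) \<le> ennreal e"
proof -
  have V0: "0 \<le> V x * (f x)\<^sup>2" "c0 * (f x)\<^sup>2 \<le> V x * (f x)\<^sup>2" for x
    using V(1)[of x] V(2) by (auto intro!: mult_right_mono)
  have le: "(\<integral>\<^sup>+x. ennreal (h x) \<partial>lebesgue) \<le> ennreal e" if "\<And>x. h x \<le> grad_sq f x + V x * (f x)\<^sup>2" for h
    using that b(1) unfolding normV_sq_def
    by (intro order_trans[OF nn_integral_mono b(1)[unfolded normV_sq_def]]) (auto intro!: ennreal_leI)
  show "(\<integral>\<^sup>+x. ennreal (V x * (f x)\<^sup>2) \<partial>lebesgue) \<le> ennreal e"
    by (rule le) (simp add: grad_sq_nonneg)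
  have m: "y \<le> max 1 (1 / c0) * e" if "y \<le> e" for y
  proof -
    have "1 * e \<le> max 1 (1 / c0) * e" using b(2) by (intro mult_right_mono) auto
    then show ?thesis using that by linarith
  qed
  have "(\<integral>\<^sup>+x. ennreal (grad_sq f x) \<partial>lebesgue) \<le> ennreal e" by (rule le) (simp add: V0)
  then have "ennreal (\<integral>x. grad_sq f x \<partial>lborel) \<le> ennreal e"
    unfolding nn_integral_completion using grad_sq_integrable[OF f]
    by (subst nn_integral_eq_integral[symmetric]) (auto simp: grad_sq_nonneg)
  then have "(\<integral>x. grad_sq f x \<partial>lborel) \<le> e" using b(2) by simp
  then show "(\<integral>x. grad_sq f x \<partial>lborel) \<le> max 1 (1 / c0) * e" by (rule m)
  have "(\<integral>\<^sup>+x. ennreal (c0 * (f x)\<^sup>2) \<partial>lebesgue) \<le> ennreal e"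
    by (rule le) (use V0 grad_sq_nonneg in \<open>metis add_increasing\<close>)
  then have "ennreal (\<integral>x. c0 * (f x)\<^sup>2 \<partial>lborel) \<le> ennreal e"
    unfolding nn_integral_completion using C1c_integrable_power2[OF f] V(2)
    by (subst nn_integral_eq_integral[symmetric]) auto
  then have "c0 * (\<integral>x. (f x)\<^sup>2 \<partial>lborel) \<le> e" using b(2) by simp
  then have "(\<integral>x. (f x)\<^sup>2 \<partial>lborel) \<le> 1 / c0 * e" using V(2) by (simp add: field_simps)
  also have "\<dots> \<le> max 1 (1 / c0) * e" using b(2) by (intro mult_right_mono) auto
  finally show "(\<integral>x. (f x)\<^sup>2 \<partial>lborel) \<le> max 1 (1 / c0) * e" .
qed

lemma L2_limit_set_integral:
  fixes u :: "'a::euclidean_space \<Rightarrow> real"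
  assumes f: "\<And>k. C1c (f k)" and u[measurable]: "u \<in> borel_measurable lebesgue"
    and lim: "(\<lambda>k. \<integral>\<^sup>+ x. ennreal ((f k x - u x)\<^sup>2) \<partial>lebesgue) \<longlonglongrightarrow> 0"
    and A: "A \<in> sets borel" "bounded A"
  shows "integrable lebesgue (\<lambda>x. indicator A x * u x)"
    and "(\<lambda>k. \<integral>x. indicator A x * f k x \<partial>lebesgue) \<longlonglongrightarrow> (\<integral>x. indicator A x * u x \<partial>lebesgue)"
proof -
  have Al: "A \<in> sets lebesgue" using A(1) by (simp add: sets_completionI_sets)
  have [measurable]: "indicator A \<in> borel_measurable lebesgue" using Al by simp
  have fm[measurable]: "f k \<in> borel_measurable lebesgue" for k
    using C1c_borel[OF f] by (intro measurable_completion) simp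
  have i2: "(indicator A x :: real)\<^sup>2 = indicator A x" for x by (simp add: indicator_def)
  have iA: "integrable lebesgue (indicator A :: 'a \<Rightarrow> real)"
    using Al A(1) emeasure_bounded_finite[OF A(2)] by (intro integrable_real_indicator) auto
  then have iA2: "integrable lebesgue (\<lambda>x. (indicator A x :: real)\<^sup>2)" unfolding i2 .
  have fi: "integrable lebesgue (\<lambda>x. indicator A x * f k x)" for k
  proof (rule integral_Cauchy_Schwarz(1)[OF _ _ iA2])
    show "integrable lebesgue (\<lambda>x. (f k x)\<^sup>2)"
      using C1c_integrable_power2[OF f[of k]] by (subst integrable_completion) auto
  qed measurable
  have ev: "\<forall>\<^sub>F k in sequentially. (\<integral>\<^sup>+ x. ennreal ((f k x - u x)\<^sup>2) \<partial>lebesgue) < \<infinity>"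
    using order_tendstoD(2)[OF lim, of \<infinity>] by simp
  have di: "integrable lebesgue (\<lambda>x. (f k x - u x)\<^sup>2)" if "(\<integral>\<^sup>+ x. ennreal ((f k x - u x)\<^sup>2) \<partial>lebesgue) < \<infinity>" for k
    using that by (intro integrableI_nonneg) auto
  obtain k0 where k0: "(\<integral>\<^sup>+ x. ennreal ((f k0 x - u x)\<^sup>2) \<partial>lebesgue) < \<infinity>"
    using eventually_happens[OF ev] by auto
  have "integrable lebesgue (\<lambda>x. indicator A x * (f k0 x - u x))"
    by (rule integral_Cauchy_Schwarz(1)[OF _ _ iA2 di[OF k0]]) measurable
  from Bochner_Integration.integrable_diff[OF fi[of k0] this]
  show ui: "integrable lebesgue (\<lambda>x. indicator A x * u x)"
    by (simp add: right_diff_distrib)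
  define m where "m = (\<integral>x. (indicator A x :: real)\<^sup>2 \<partial>lebesgue)"
  have bound: "\<bar>(\<integral>x. indicator A x * f k x \<partial>lebesgue) - (\<integral>x. indicator A x * u x \<partial>lebesgue)\<bar>
      \<le> sqrt (m * enn2real (\<integral>\<^sup>+ x. ennreal ((f k x - u x)\<^sup>2) \<partial>lebesgue))"
    if k: "(\<integral>\<^sup>+ x. ennreal ((f k x - u x)\<^sup>2) \<partial>lebesgue) < \<infinity>" for k
  proof -
    have "(\<integral>x. indicator A x * f k x \<partial>lebesgue) - (\<integral>x. indicator A x * u x \<partial>lebesgue)
       = (\<integral>x. indicator A x * (f k x - u x) \<partial>lebesgue)"
      using fi[of k] ui by (simp add: right_diff_distrib)
    also have "\<bar>\<dots>\<bar> \<le> (\<integral>x. \<bar>indicator A x * (f k x - u x)\<bar> \<partial>lebesgue)" by (rule integral_abs_bound)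
    also have "\<dots> \<le> sqrt (m * (\<integral>x. (f k x - u x)\<^sup>2 \<partial>lebesgue))"
      unfolding m_def by (rule integral_Cauchy_Schwarz(2)[OF _ _ iA2 di[OF k]]) measurable
    also have "(\<integral>x. (f k x - u x)\<^sup>2 \<partial>lebesgue) = enn2real (\<integral>\<^sup>+ x. ennreal ((f k x - u x)\<^sup>2) \<partial>lebesgue)"
      by (rule integral_eq_nn_integral) auto
    finally show ?thesis .
  qed
  have "(\<lambda>k. enn2real (\<integral>\<^sup>+ x. ennreal ((f k x - u x)\<^sup>2) \<partial>lebesgue)) \<longlonglongrightarrow> 0"
    using tendsto_enn2real[of _ 0] lim by simp
  from tendsto_real_sqrt[OF tendsto_mult_left[OF this, of m]]
  have "(\<lambda>k. sqrt (m * enn2real (\<integral>\<^sup>+ x. ennreal ((f k x - u x)\<^sup>2) \<partial>lebesgue))) \<longlonglongrightarrow> 0" by simp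
  then have "(\<lambda>k. (\<integral>x. indicator A x * f k x \<partial>lebesgue) - (\<integral>x. indicator A x * u x \<partial>lebesgue)) \<longlonglongrightarrow> 0"
    by (rule Lim_null_comparison[rotated]) (use ev in eventually_elim, use bound in auto)
  then show "(\<lambda>k. \<integral>x. indicator A x * f k x \<partial>lebesgue) \<longlonglongrightarrow> (\<integral>x. indicator A x * u x \<partial>lebesgue)"
    by (rule LIM_zero_cancel)
qed

lemma L2_limit_weighted_bound:
  fixes u V :: "'a::euclidean_space \<Rightarrow> real"
  assumes f: "\<And>k. C1c (f k)" and u[measurable]: "u \<in> borel_measurable lebesgue"
    and lim: "(\<lambda>k. \<integral>\<^sup>+ x. ennreal ((f k x - u x)\<^sup>2) \<partial>lebesgue) \<longlonglongrightarrow> 0"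
    and V: "continuous_on UNIV V" "\<And>x. 0 \<le> V x"
    and b: "\<And>k. (\<integral>\<^sup>+ x. ennreal (V x * (f k x)\<^sup>2) \<partial>lebesgue) \<le> ennreal e"
  shows "(\<integral>\<^sup>+ x. ennreal (V x * (u x)\<^sup>2) \<partial>lebesgue) \<le> 2 * ennreal e"
proof -
  have fm[measurable]: "f k \<in> borel_measurable lebesgue" for k
    using C1c_borel[OF f] by (intro measurable_completion) simp
  have Vm[measurable]: "V \<in> borel_measurable lebesgue"
    using borel_measurable_continuous_onI[OF V(1)] by (intro measurable_completion) simp
  have bm[measurable]: "cball 0 (real j) \<in> sets lebesgue" for j by (intro sets_completionI_sets) auto
  have ball: "(\<integral>\<^sup>+ x. indicator (cball 0 (real j)) x * ennreal (V x * (u x)\<^sup>2) \<partial>lebesgue) \<le> 2 * ennreal e" for j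
  proof -
    have "compact (V ` cball 0 (real j))"
      by (intro compact_continuous_image continuous_on_subset[OF V(1)]) auto
    then have "bounded (V ` cball 0 (real j))" by (rule compact_imp_bounded)
    then obtain K where K: "0 < K" "\<forall>y\<in>V ` cball 0 (real j). norm y \<le> K"
      unfolding bounded_pos by (elim exE conjE)
    have le: "(\<integral>\<^sup>+ x. indicator (cball 0 (real j)) x * ennreal (V x * (u x)\<^sup>2) \<partial>lebesgue)
       \<le> 2 * ennreal e + ennreal (2 * K) * (\<integral>\<^sup>+ x. ennreal ((f k x - u x)\<^sup>2) \<partial>lebesgue)" for k
    proof -
      have pt: "indicator (cball 0 (real j)) x * ennreal (V x * (u x)\<^sup>2)
        \<le> 2 * ennreal (V x * (f k x)\<^sup>2) + ennreal (2 * K) * ennreal ((f k x - u x)\<^sup>2)" for x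
      proof (cases "x \<in> cball 0 (real j)")
        case True
        then have "norm (V x) \<le> K" using K(2) by blast
        then have VK: "V x \<le> K" by simp
        have "(u x)\<^sup>2 \<le> 2 * (f k x)\<^sup>2 + 2 * (f k x - u x)\<^sup>2"
          using zero_le_power2[of "2 * f k x - u x"] by (simp add: power2_eq_square algebra_simps)
        then have "V x * (u x)\<^sup>2 \<le> V x * (2 * (f k x)\<^sup>2 + 2 * (f k x - u x)\<^sup>2)"
          using V(2)[of x] by (rule mult_left_mono)
        also have "\<dots> = 2 * (V x * (f k x)\<^sup>2) + V x * (2 * (f k x - u x)\<^sup>2)" by (simp add: algebra_simps)
        also have "\<dots> \<le> 2 * (V x * (f k x)\<^sup>2) + K * (2 * (f k x - u x)\<^sup>2)"
          using VK by (intro add_left_mono mult_right_mono) auto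
        finally have "ennreal (V x * (u x)\<^sup>2) \<le> ennreal (2 * (V x * (f k x)\<^sup>2) + (2 * K) * (f k x - u x)\<^sup>2)"
          by (intro ennreal_leI) (simp add: mult_ac)
        also have "\<dots> = 2 * ennreal (V x * (f k x)\<^sup>2) + ennreal (2 * K) * ennreal ((f k x - u x)\<^sup>2)"
          using K(1) V(2)[of x] by (simp add: ennreal_mult)
        finally show ?thesis using True by simp
      qed simp
      have "(\<integral>\<^sup>+ x. indicator (cball 0 (real j)) x * ennreal (V x * (u x)\<^sup>2) \<partial>lebesgue)
        \<le> (\<integral>\<^sup>+ x. 2 * ennreal (V x * (f k x)\<^sup>2) + ennreal (2 * K) * ennreal ((f k x - u x)\<^sup>2) \<partial>lebesgue)"
        by (rule nn_integral_mono) (rule pt)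
      also have "\<dots> = 2 * (\<integral>\<^sup>+ x. ennreal (V x * (f k x)\<^sup>2) \<partial>lebesgue) + ennreal (2 * K) * (\<integral>\<^sup>+ x. ennreal ((f k x - u x)\<^sup>2) \<partial>lebesgue)"
        by (simp add: nn_integral_add nn_integral_cmult)
      also have "\<dots> \<le> 2 * ennreal e + ennreal (2 * K) * (\<integral>\<^sup>+ x. ennreal ((f k x - u x)\<^sup>2) \<partial>lebesgue)"
        using b[of k] by (intro add_right_mono mult_left_mono) auto
      finally show ?thesis .
    qed
    have "(\<lambda>k. 2 * ennreal e + ennreal (2 * K) * (\<integral>\<^sup>+ x. ennreal ((f k x - u x)\<^sup>2) \<partial>lebesgue)) \<longlonglongrightarrow> 2 * ennreal e + ennreal (2 * K) * 0"
      by (intro tendsto_add tendsto_const ennreal_tendsto_cmult lim) simp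
    then show ?thesis using le by (intro LIMSEQ_le_const) auto
  qed
  have "(\<lambda>j. \<integral>\<^sup>+ x. indicator (cball 0 (real j)) x * ennreal (V x * (u x)\<^sup>2) \<partial>lebesgue)
     \<longlonglongrightarrow> (\<integral>\<^sup>+ x. ennreal (V x * (u x)\<^sup>2) \<partial>lebesgue)"
  proof (rule nn_integral_LIMSEQ)
    show "incseq (\<lambda>j x. indicator (cball 0 (real j)) x * ennreal (V x * (u x)\<^sup>2))"
      by (auto simp: incseq_def le_fun_def indicator_def)
    show "(\<lambda>j. indicator (cball 0 (real j)) x * ennreal (V x * (u x)\<^sup>2)) \<longlonglongrightarrow> ennreal (V x * (u x)\<^sup>2)" for x
    proof (rule tendsto_eventually)
      obtain j0 where "norm x \<le> real j0" using real_arch_simple by blast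
      then show "\<forall>\<^sub>F j in sequentially. indicator (cball 0 (real j)) x * ennreal (V x * (u x)\<^sup>2) = ennreal (V x * (u x)\<^sup>2)"
        by (intro eventually_sequentiallyI[of j0]) (auto simp: indicator_def)
    qed
  qed measurable
  then show ?thesis using ball by (intro LIMSEQ_le_const2) auto
qed

lemma H1V_radial_profile:
  fixes u V :: "'a::euclidean_space \<Rightarrow> real"
  defines "n \<equiv> DIM('a) - 1"
  assumes V: "continuous_on UNIV V" "\<And>x. c0 \<le> V x" "0 < c0"
    and \<alpha>: "0 < \<alpha>"
    and env: "\<And>(f::'a \<Rightarrow> real) H r. C1c f \<Longrightarrow> (\<integral>x. grad_sq f x \<partial>lborel) \<le> H\<^sup>2 \<Longrightarrow> (\<integral>x. (f x)\<^sup>2 \<partial>lborel) \<le> H\<^sup>2 \<Longrightarrow>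
      0 \<le> H \<Longrightarrow> 0 < r \<Longrightarrow> \<bar>sph_mean f r\<bar> \<le> B * H * envelope n \<alpha> r" "0 < B"
    and u: "radial u" "H1V_bounded_by V M u"
    and H: "0 \<le> H" "max 1 (1 / c0) * M\<^sup>2 \<le> H\<^sup>2"
  obtains U where "U \<in> borel_measurable borel" "AE x in lebesgue. u x = U (norm x)"
    "\<And>r. 0 < r \<Longrightarrow> \<bar>U r\<bar> \<le> B * H * envelope n \<alpha> r"
    "\<And>r s. 0 < r \<Longrightarrow> r \<le> s \<Longrightarrow> \<bar>U r - U s\<bar> \<le> sqrt (H\<^sup>2 * ((s - r) / r ^ n) / sphere_area TYPE('a))"
    "(\<integral>\<^sup>+ x. ennreal (V x * (u x)\<^sup>2) \<partial>lebesgue) \<le> 2 * ennreal (M\<^sup>2)"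
proof -
  have um[measurable]: "u \<in> borel_measurable lebesgue" using u(2) by (simp add: H1V_bounded_by_def)
  from u(2) obtain f where app: "H1V_approx V u f" and M: "\<And>k. normV_sq V (f k) \<le> ennreal (M\<^sup>2)"
    unfolding H1V_bounded_by_def by blast
  have f: "C1c (f k)" for k using app C0_inf_imp_C1c by (auto simp: H1V_approx_def)
  have cau: "\<exists>K. \<forall>m\<ge>K. \<forall>n\<ge>K. normV_sq V (\<lambda>x. f m x - f n x) < ennreal e" if "0 < e" for e
    using app that by (auto simp: H1V_approx_def)
  have lim: "(\<lambda>k. \<integral>\<^sup>+ x. ennreal ((f k x - u x)\<^sup>2) \<partial>lebesgue) \<longlonglongrightarrow> 0"
    using app by (auto simp: H1V_approx_def)
  define c where "c = sphere_area TYPE('a)"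
  have c: "0 < c" unfolding c_def by (rule sphere_area_pos)
  define \<kappa> where "\<kappa> = max 1 (1 / c0)"
  have \<kappa>: "1 \<le> \<kappa>" by (simp add: \<kappa>_def)
  have G: "(\<integral>x. grad_sq (f k) x \<partial>lborel) \<le> H\<^sup>2" "(\<integral>x. (f k x)\<^sup>2 \<partial>lborel) \<le> H\<^sup>2" for k
    using normV_sq_bounds(1,2)[OF f V(2,3) M[of k]] H(2) by auto
  have conv: "convergent (\<lambda>k. sph_mean (f k) r)" if r: "0 < r" for r
  proof -
    define E where "E = B * envelope n \<alpha> r + 1"
    have E: "0 < E" using env(2) envelope_nonneg[of n \<alpha> r] by (simp add: E_def add_nonneg_pos)
    have "Cauchy (\<lambda>k. sph_mean (f k) r)"
    proof (rule CauchyI)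
      fix \<epsilon> :: real assume \<epsilon>: "0 < \<epsilon>"
      define d where "d = \<epsilon> / (2 * E)"
      have d: "0 < d" using \<epsilon> E by (simp add: d_def)
      have "0 < d\<^sup>2 / \<kappa>" using d \<kappa> by simp
      from cau[OF this] obtain K where K: "\<And>m n. K \<le> m \<Longrightarrow> K \<le> n \<Longrightarrow> normV_sq V (\<lambda>x. f m x - f n x) < ennreal (d\<^sup>2 / \<kappa>)" by blast
      have "norm (sph_mean (f i) r - sph_mean (f j) r) < \<epsilon>" if ij: "K \<le> i" "K \<le> j" for i j
      proof -
        have fij: "C1c (\<lambda>x. f i x - f j x)" by (intro C1c_diff f)
        have "normV_sq V (\<lambda>x. f i x - f j x) \<le> ennreal (d\<^sup>2 / \<kappa>)" using K[OF ij] by simp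
        from normV_sq_bounds(1,2)[OF fij V(2,3) this] \<kappa>
        have "(\<integral>x. grad_sq (\<lambda>x. f i x - f j x) x \<partial>lborel) \<le> d\<^sup>2" "(\<integral>x. (f i x - f j x)\<^sup>2 \<partial>lborel) \<le> d\<^sup>2"
          by (auto simp flip: \<kappa>_def)
        from env(1)[OF fij this] d r have "\<bar>sph_mean (\<lambda>x. f i x - f j x) r\<bar> \<le> B * d * envelope n \<alpha> r" by simp
        also have "\<dots> \<le> d * E" using d by (simp add: E_def algebra_simps)
        also have "\<dots> < \<epsilon>" using \<epsilon> E by (simp add: d_def)
        finally show ?thesis by (simp add: sph_mean_diff[OF f f r])
      qed
      then show "\<exists>K. \<forall>m\<ge>K. \<forall>n\<ge>K. norm (sph_mean (f m) r - sph_mean (f n) r) < \<epsilon>" by blast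
    qed
    then show ?thesis by (rule Cauchy_convergent)
  qed
  define F where "F = (\<lambda>k r. if 0 < r then sph_mean (f k) r else 0)"
  define U where "U = (\<lambda>r. if 0 < r then lim (\<lambda>k. sph_mean (f k) r) else 0)"
  have FU: "(\<lambda>k. F k r) \<longlonglongrightarrow> U r" for r
    using conv[of r] by (auto simp: F_def U_def convergent_LIMSEQ_iff)
  have Fm[measurable]: "F k \<in> borel_measurable borel" for k
    unfolding F_def using sph_mean_borel[OF f[of k]] by measurable
  have Um[measurable]: "U \<in> borel_measurable borel"
    by (rule borel_measurable_LIMSEQ_real[OF FU Fm])
  have Fb: "\<bar>F k r\<bar> \<le> B * H * envelope n \<alpha> r" if "0 < r" for k r
    using env(1)[OF f G H(1) that] that by (simp add: F_def)
  have Ub: "\<bar>U r\<bar> \<le> B * H * envelope n \<alpha> r" if "0 < r" for r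
    using tendsto_rabs[OF FU[of r]] Fb[OF that] by (intro LIMSEQ_le_const2) auto
  have Fh: "\<bar>F k r - F k s\<bar> \<le> sqrt (H\<^sup>2 * ((s - r) / r ^ n) / c)" if rs: "0 < r" "r \<le> s" for k r s
  proof -
    have "\<bar>F k r - F k s\<bar> \<le> sqrt ((\<integral>x. grad_sq (f k) x \<partial>lborel) * radial_weight n r s / c)"
      using sph_mean_dist_le[OF f rs] rs unfolding n_def c_def by (simp add: F_def)
    also have "\<dots> \<le> sqrt (H\<^sup>2 * ((s - r) / r ^ n) / c)"
      using c G(1)[of k] radial_weight_le[OF rs, of n] radial_weight_nonneg[OF rs(1), of n s]
      by (intro real_sqrt_le_mono divide_right_mono mult_mono) auto
    finally show ?thesis .
  qed
  have Uh: "\<bar>U r - U s\<bar> \<le> sqrt (H\<^sup>2 * ((s - r) / r ^ n) / c)" if rs: "0 < r" "r \<le> s" for r s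
    using tendsto_rabs[OF tendsto_diff[OF FU[of r] FU[of s]]] Fh[OF rs] by (intro LIMSEQ_le_const2) auto

  have Unm: "(\<lambda>x::'a. U (norm x)) \<in> borel_measurable lborel" by measurable
  have key: "integrable lebesgue (\<lambda>x. indicator C (norm x) * (u x - U (norm x))) \<and>
     (\<integral>x. indicator C (norm x) * (u x - U (norm x)) \<partial>lebesgue) = 0" if C: "compact C" "C \<subseteq> {0<..}" for C
  proof -
    obtain a b where ab: "0 < a" "C \<subseteq> {a..b}"
    proof (cases "C = {}")
      case True then show ?thesis using that[of 1] by simp
    next
      case False
      obtain a where a: "a \<in> C" "\<forall>t\<in>C. a \<le> t" using compact_attains_inf[OF C(1) False] by blast
      obtain b where b: "b \<in> C" "\<forall>t\<in>C. t \<le> b" using compact_attains_sup[OF C(1) False] by blast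
      have "0 < a" "C \<subseteq> {a..b}" using a b C(2) by auto
      then show ?thesis by (rule that)
    qed
    have Cm[measurable]: "C \<in> sets borel" using C(1) by (rule borel_compact)
    define A where "A = {x::'a. norm x \<in> C}"
    have Am[measurable]: "A \<in> sets borel" unfolding A_def by measurable
    have Ab: "bounded A" by (rule bounded_subset[OF bounded_cball[of 0 b]]) (use ab in \<open>auto simp: A_def\<close>)
    have AC: "indicator C (norm x) = (indicator A x :: real)" for x by (simp add: A_def indicator_def)
    have bdd: "\<bar>indicator A x * F k (norm x)\<bar> \<le> B * H * (1 + a powr (- \<alpha>)) * indicator A x" for k x
    proof (cases "x \<in> A")
      case True
      then have x: "a \<le> norm x" using ab by (auto simp: A_def)
      have "\<bar>F k (norm x)\<bar> \<le> B * H * envelope n \<alpha> (norm x)" by (rule Fb) (use x ab in linarith)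
      also have "\<dots> \<le> B * H * (1 + a powr (- \<alpha>))"
        using envelope_le[OF ab(1) x, of \<alpha> n] \<alpha> env(2) H(1) by (intro mult_left_mono) auto
      finally show ?thesis using True by simp
    qed simp
    have iA: "integrable lborel (\<lambda>x. B * H * (1 + a powr (- \<alpha>)) * indicator A x)"
      using Am emeasure_bounded_finite[OF Ab] by (intro integrable_mult_right integrable_real_indicator) auto
    have conv: "AE x in lborel. (\<lambda>k. indicator A x * F k (norm x)) \<longlonglongrightarrow> indicator A x * U (norm x)"
      by (intro AE_I2 tendsto_mult_left FU)
    have AE_bdd: "AE x in lborel. norm (indicator A x * F k (norm x)) \<le> B * H * (1 + a powr (- \<alpha>)) * indicator A x" for k
      using bdd by (intro AE_I2) simp
    have mF: "(\<lambda>x. indicator A x * F k (norm x)) \<in> borel_measurable lborel" for k by measurable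
    have mU: "(\<lambda>x. indicator A x * U (norm x)) \<in> borel_measurable lborel" by measurable
    have L1: "(\<lambda>k. \<integral>x. indicator A x * F k (norm x) \<partial>lborel) \<longlonglongrightarrow> (\<integral>x. indicator A x * U (norm x) \<partial>lborel)"
      and Ui: "integrable lborel (\<lambda>x. indicator A x * U (norm x))"
      by (rule integral_dominated_convergence[OF mU mF iA conv AE_bdd])
        (rule integrable_dominated_convergence[OF mU mF iA conv AE_bdd])
    note L2 = L2_limit_set_integral[OF f um lim Am Ab]
    have "(\<integral>x. indicator A x * f k x \<partial>lebesgue) = (\<integral>x. indicator A x * F k (norm x) \<partial>lborel)" for k
    proof -
      have "(\<integral>x. indicator A x * f k x \<partial>lebesgue) = (\<integral>x. indicator A x * f k x \<partial>lborel)"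
        using C1c_borel[OF f[of k]] Am by (intro integral_completion) simp
      also have "\<dots> = (\<integral>x. indicator A x * sph_mean (f k) (norm x) \<partial>lborel)"
        using integral_sph_mean[OF f[of k] Cm ab(2,1)] unfolding AC .
      also have "\<dots> = (\<integral>x. indicator A x * F k (norm x) \<partial>lborel)"
        using C(2) by (intro Bochner_Integration.integral_cong) (auto simp: F_def A_def indicator_def)
      finally show ?thesis .
    qed
    with L1 L2(2) have "(\<integral>x. indicator A x * u x \<partial>lebesgue) = (\<integral>x. indicator A x * U (norm x) \<partial>lborel)"
      by (simp add: LIMSEQ_unique)
    also have "\<dots> = (\<integral>x. indicator A x * U (norm x) \<partial>lebesgue)"
      by (rule integral_completion[symmetric, OF mU])
    finally have eq: "(\<integral>x. indicator A x * u x \<partial>lebesgue) = (\<integral>x. indicator A x * U (norm x) \<partial>lebesgue)" .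
    have Ui': "integrable lebesgue (\<lambda>x. indicator A x * U (norm x))"
      using Ui integrable_completion[OF mU] by simp
    show ?thesis unfolding AC right_diff_distrib using L2(1) Ui' eq by simp
  qed
  have "AE x in lebesgue. u x - U (norm x) = 0"
  proof (rule radial_AE_zero)
    show "radial (\<lambda>x. u x - U (norm x))" using u(1) unfolding radial_def by metis
    show "(\<lambda>x. u x - U (norm x)) \<in> borel_measurable lebesgue"
      using um measurable_completion[OF Unm] by (rule borel_measurable_diff)
  qed (use key in blast)+
  then have AE: "AE x in lebesgue. u x = U (norm x)" by simp
  have "0 \<le> V x" for x using V(2)[of x] V(3) by linarith
  then have "(\<integral>\<^sup>+ x. ennreal (V x * (u x)\<^sup>2) \<partial>lebesgue) \<le> 2 * ennreal (M\<^sup>2)"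
    using normV_sq_bounds(3)[OF f V(2,3) M] by (intro L2_limit_weighted_bound[OF f um lim V(1)]) auto
  then show ?thesis using that[OF Um AE Ub] Uh unfolding c_def by blast
qed

lemma normV_sq_finite:
  fixes f V :: "'a::euclidean_space \<Rightarrow> real"
  assumes f: "C1c f" and V: "continuous_on UNIV V"
  shows "normV_sq V f < \<infinity>"
proof -
  obtain \<rho> where \<rho>: "0 < \<rho>" "\<And>x. \<rho> < norm x \<Longrightarrow> f x = 0" "\<And>x. \<rho> < norm x \<Longrightarrow> frechet_derivative f (at x) = (\<lambda>_. 0)"
    using C1c_support[OF f] by blast
  have "integrable lborel (\<lambda>x. grad_sq f x + V x * (f x)\<^sup>2)"
  proof (rule integrable_continuous_bounded_support)
    show "continuous_on UNIV (\<lambda>x. grad_sq f x + V x * (f x)\<^sup>2)"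
      using grad_sq_continuous[OF f] C1c_continuous[OF f] V
      by (intro continuous_on_add continuous_on_mult continuous_on_power)
    show "grad_sq f x + V x * (f x)\<^sup>2 = 0" if "\<rho> < norm x" for x
      using \<rho>(2,3)[OF that] by (simp add: grad_sq_def)
  qed
  then show ?thesis
    unfolding normV_sq_def nn_integral_completion real_integrable_def by (simp add: less_top)
qed

lemma normV_sq_le_diff:
  fixes f g V :: "'a::euclidean_space \<Rightarrow> real"
  assumes f: "C1c f" and g: "C1c g" and V: "continuous_on UNIV V" "\<And>x. 0 \<le> V x"
  shows "normV_sq V f \<le> 2 * normV_sq V (\<lambda>x. f x - g x) + 2 * normV_sq V g"
proof -
  have sq: "a\<^sup>2 \<le> 2 * (a - b)\<^sup>2 + 2 * b\<^sup>2" for a b :: real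
    using zero_le_power2[of "a - 2 * b"] by (simp add: power2_eq_square algebra_simps)
  have m[measurable]: "(\<lambda>x. ennreal (grad_sq h x + V x * (h x)\<^sup>2)) \<in> borel_measurable lebesgue" if h: "C1c h" for h
  proof -
    have [measurable]: "grad_sq h \<in> borel_measurable borel" "h \<in> borel_measurable borel" "V \<in> borel_measurable borel"
      using grad_sq_continuous[OF h] C1c_continuous[OF h] V(1) by (auto intro: borel_measurable_continuous_onI)
    show ?thesis by (rule measurable_completion) measurable
  qed
  have pt: "ennreal (grad_sq f x + V x * (f x)\<^sup>2) \<le> 2 * ennreal (grad_sq (\<lambda>x. f x - g x) x + V x * (f x - g x)\<^sup>2)
      + 2 * ennreal (grad_sq g x + V x * (g x)\<^sup>2)" for x
  proof -
    have "grad_sq f x \<le> (\<Sum>b\<in>Basis. 2 * (frechet_derivative f (at x) b - frechet_derivative g (at x) b)\<^sup>2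
        + 2 * (frechet_derivative g (at x) b)\<^sup>2)"
      unfolding grad_sq_def by (intro sum_mono sq)
    also have "\<dots> = 2 * grad_sq (\<lambda>x. f x - g x) x + 2 * grad_sq g x"
      by (simp add: grad_sq_def frechet_derivative_diff[OF f g] sum.distrib sum_distrib_left)
    finally have 1: "grad_sq f x \<le> 2 * grad_sq (\<lambda>x. f x - g x) x + 2 * grad_sq g x" .
    have "V x * (f x)\<^sup>2 \<le> V x * (2 * (f x - g x)\<^sup>2 + 2 * (g x)\<^sup>2)"
      using V(2) sq by (intro mult_left_mono)
    then have "grad_sq f x + V x * (f x)\<^sup>2 \<le> 2 * (grad_sq (\<lambda>x. f x - g x) x + V x * (f x - g x)\<^sup>2)
      + 2 * (grad_sq g x + V x * (g x)\<^sup>2)" using 1 by (simp add: algebra_simps)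
    then have "ennreal (grad_sq f x + V x * (f x)\<^sup>2) \<le> ennreal (2 * (grad_sq (\<lambda>x. f x - g x) x + V x * (f x - g x)\<^sup>2)
      + 2 * (grad_sq g x + V x * (g x)\<^sup>2))" by (rule ennreal_leI)
    also have "\<dots> = 2 * ennreal (grad_sq (\<lambda>x. f x - g x) x + V x * (f x - g x)\<^sup>2)
      + 2 * ennreal (grad_sq g x + V x * (g x)\<^sup>2)"
      using V(2)[of x] by (simp add: ennreal_mult' grad_sq_nonneg)
    finally show ?thesis .
  qed
  have "normV_sq V f \<le> (\<integral>\<^sup>+x. 2 * ennreal (grad_sq (\<lambda>x. f x - g x) x + V x * (f x - g x)\<^sup>2)
      + 2 * ennreal (grad_sq g x + V x * (g x)\<^sup>2) \<partial>lebesgue)"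
    unfolding normV_sq_def by (rule nn_integral_mono) (rule pt)
  also have "\<dots> = 2 * normV_sq V (\<lambda>x. f x - g x) + 2 * normV_sq V g"
    unfolding normV_sq_def using m[OF C1c_diff[OF f g]] m[OF g]
    by (subst nn_integral_add) (auto simp: nn_integral_cmult)
  finally show ?thesis .
qed

lemma H1V_imp_bounded:
  fixes u V :: "'a::euclidean_space \<Rightarrow> real"
  assumes u: "u \<in> H1V V" and V: "continuous_on UNIV V" "\<And>x. 0 \<le> V x"
  obtains M where "H1V_bounded_by V M u"
proof -
  from u obtain f where um: "u \<in> borel_measurable lebesgue" and app: "H1V_approx V u f" by (auto simp: H1V_def)
  have f: "C1c (f k)" for k using app C0_inf_imp_C1c by (auto simp: H1V_approx_def)
  have cau: "\<exists>K. \<forall>m\<ge>K. \<forall>n\<ge>K. normV_sq V (\<lambda>x. f m x - f n x) < ennreal e" if "0 < e" for e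
    using app that by (auto simp: H1V_approx_def)
  obtain K where K: "\<And>m n. K \<le> m \<Longrightarrow> K \<le> n \<Longrightarrow> normV_sq V (\<lambda>x. f m x - f n x) < ennreal 1"
    using cau[of 1] by auto
  define Q where "Q = enn2real (normV_sq V (f K))"
  have Q: "normV_sq V (f K) = ennreal Q" "0 \<le> Q"
    using normV_sq_finite[OF f[of K] V(1)] by (auto simp: Q_def)
  define M where "M = sqrt (2 + 2 * Q)"
  have b: "normV_sq V (f (k + K)) \<le> ennreal (M\<^sup>2)" for k
  proof -
    have "normV_sq V (f (k + K)) \<le> 2 * normV_sq V (\<lambda>x. f (k + K) x - f K x) + 2 * normV_sq V (f K)"
      by (rule normV_sq_le_diff[OF f f V])
    also have "\<dots> \<le> 2 * ennreal 1 + 2 * ennreal Q"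
      using K[of "k + K" K] Q(1) by (intro add_mono mult_left_mono) auto
    also have "\<dots> = ennreal (M\<^sup>2)" using Q(2) by (simp add: M_def ennreal_mult')
    finally show ?thesis .
  qed
  have "H1V_approx V u (\<lambda>k. f (k + K))"
    unfolding H1V_approx_def
  proof (intro conjI allI impI)
    show "f (k + K) \<in> C0_inf" for k using app by (simp add: H1V_approx_def)
    show "\<exists>Ka. \<forall>m\<ge>Ka. \<forall>n\<ge>Ka. normV_sq V (\<lambda>x. f (m + K) x - f (n + K) x) < ennreal e" if "0 < e" for e
      using cau[OF that] by (meson trans_le_add1)
    show "(\<lambda>k. \<integral>\<^sup>+ x. ennreal ((f (k + K) x - u x)\<^sup>2) \<partial>lebesgue) \<longlonglongrightarrow> 0"
      using app by (intro LIMSEQ_ignore_initial_segment) (simp add: H1V_approx_def)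
  qed
  then have "H1V_bounded_by V M u" unfolding H1V_bounded_by_def using um b by blast
  then show ?thesis by (rule that)
qed

section \<open>Compactness\<close>

lemma envelope_powr_integrable:
  assumes \<alpha>: "0 < \<alpha>" "\<alpha> * \<tau> < real DIM('a::euclidean_space)" "0 < \<tau>"
  shows "integrable lborel (\<lambda>x::'a. indicator {..R} (norm x) * envelope (DIM('a) - 1) \<alpha> (norm x) powr \<tau>)"
proof -
  define n where "n = DIM('a) - 1"
  have n: "real n = real DIM('a) - 1" by (simp add: n_def of_nat_diff)
  define c where "c = sphere_area TYPE('a)"
  have c: "0 < c" unfolding c_def by (rule sphere_area_pos)
  define \<beta> where "\<beta> = real n - \<alpha> * \<tau>"
  have \<beta>: "-1 < \<beta>" using \<alpha>(2) n by (simp add: \<beta>_def)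
  have "(\<lambda>s. s powr \<beta>) integrable_on {0..1}" using \<beta> by (rule integrable_on_powr_from_0) simp
  then have "(\<lambda>s. s powr \<beta>) absolutely_integrable_on {0..1::real}"
    by (intro nonnegative_absolutely_integrable_1) auto
  then have "integrable lebesgue (\<lambda>s. indicator {0..1} s * s powr \<beta>)"
    by (simp add: set_integrable_def)
  then have 1: "integrable lborel (\<lambda>s. indicator {0..1} s * s powr \<beta>)"
    by (subst (asm) integrable_completion) measurable
  have 2: "integrable lborel (\<lambda>s. indicator {0..R} s * R ^ n)"
    using emeasure_bounded_finite[of "{0..R}"] by (intro integrable_mult_left integrable_real_indicator) auto
  have "integrable lborel (\<lambda>s. c * (indicator {0..1} s * s powr \<beta>) + c * (indicator {0..R} s * R ^ n))"
    using 1 2 by simp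
  then have "integrable lborel (\<lambda>s. indicator {0..} s * (c * s ^ n) * (indicator {..R} s * envelope n \<alpha> s powr \<tau>))"
  proof (rule Bochner_Integration.integrable_bound)
    show "AE s in lborel. norm (indicator {0..} s * (c * s ^ n) * (indicator {..R} s * envelope n \<alpha> s powr \<tau>))
       \<le> norm (c * (indicator {0..1} s * s powr \<beta>) + c * (indicator {0..R} s * R ^ n))"
    proof (rule AE_I2)
      fix s :: real
      show "norm (indicator {0..} s * (c * s ^ n) * (indicator {..R} s * envelope n \<alpha> s powr \<tau>))
       \<le> norm (c * (indicator {0..1} s * s powr \<beta>) + c * (indicator {0..R} s * R ^ n))"
      proof (cases "0 \<le> s \<and> s \<le> R")
        case True
        have R: "0 \<le> c * R ^ n" using True c by simp
        have lhs: "norm (indicator {0..} s * (c * s ^ n) * (indicator {..R} s * envelope n \<alpha> s powr \<tau>))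
            = c * (s ^ n * envelope n \<alpha> s powr \<tau>)"
          using True c by (simp add: abs_mult)
        show ?thesis
        proof (cases "s \<le> 1")
          case s1: True
          have "s ^ n * envelope n \<alpha> s powr \<tau> = s powr \<beta>"
          proof (cases "s = 0")
            case False
            with True have "0 < s" by simp
            then show ?thesis using s1
              by (simp add: envelope_def \<beta>_def powr_powr powr_realpow[symmetric] powr_add[symmetric])
          qed (simp add: envelope_def)
          then show ?thesis unfolding lhs using True s1 c R by simp
        next
          case False
          have "envelope n \<alpha> s powr \<tau> \<le> 1"
          proof -
            have "s powr (- real n / 2) \<le> s powr 0" using False by (intro powr_mono) auto
            then have "envelope n \<alpha> s \<le> 1" using False by (simp add: envelope_def)
            then have "envelope n \<alpha> s powr \<tau> \<le> 1 powr \<tau>"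
              using \<alpha>(3) by (intro powr_mono2 envelope_nonneg) auto
            then show ?thesis by simp
          qed
          then have "s ^ n * envelope n \<alpha> s powr \<tau> \<le> R ^ n * 1"
            using True by (intro mult_mono power_mono) auto
          then have "c * (s ^ n * envelope n \<alpha> s powr \<tau>) \<le> c * R ^ n" using c by simp
          then show ?thesis unfolding lhs using True False by simp
        qed
      qed (auto simp: indicator_def)
    qed
  qed measurable
  then show ?thesis
    using integrable_norm_lborel_iff[where 'a = 'a and h = "\<lambda>s. indicator {..R} s * envelope n \<alpha> s powr \<tau>"]
    unfolding n_def c_def by simp
qed

lemma envelope_ball_finite:
  fixes W :: "'a::euclidean_space \<Rightarrow> real"
  assumes \<alpha>: "0 < \<alpha>" "\<alpha> * \<tau> < real DIM('a)" "0 < \<tau>" and W: "continuous_on UNIV W" and A: "0 \<le> A"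
  shows "(\<integral>\<^sup>+x. ennreal (indicator (cball 0 R) x * (W x * (A * envelope (DIM('a) - 1) \<alpha> (norm x)) powr \<tau>)) \<partial>lebesgue) < \<infinity>"
proof -
  have "compact (W ` cball 0 R)"
    by (intro compact_continuous_image continuous_on_subset[OF W]) auto
  then have "bounded (W ` cball 0 R)" by (rule compact_imp_bounded)
  then obtain K where K: "0 < K" "\<forall>y\<in>W ` cball 0 R. norm y \<le> K"
    unfolding bounded_pos by (elim exE conjE)
  let ?h = "\<lambda>x::'a. K * A powr \<tau> * (indicator {..R} (norm x) * envelope (DIM('a) - 1) \<alpha> (norm x) powr \<tau>)"
  have pt: "indicator (cball 0 R) x * (W x * (A * envelope (DIM('a) - 1) \<alpha> (norm x)) powr \<tau>) \<le> ?h x" for x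
  proof (cases "x \<in> cball 0 R")
    case True
    then have "norm (W x) \<le> K" using K(2) by blast
    then have WK: "W x \<le> K" by simp
    have "W x * (A * envelope (DIM('a) - 1) \<alpha> (norm x)) powr \<tau> \<le> K * (A * envelope (DIM('a) - 1) \<alpha> (norm x)) powr \<tau>"
      using WK by (intro mult_right_mono) auto
    also have "\<dots> = K * (A powr \<tau> * envelope (DIM('a) - 1) \<alpha> (norm x) powr \<tau>)"
      using A envelope_nonneg by (simp add: powr_mult)
    finally show ?thesis using True by simp
  qed (simp add: indicator_def)
  have i: "integrable lborel ?h" using envelope_powr_integrable[OF \<alpha>, of R] by simp
  have "(\<integral>\<^sup>+x. ennreal (indicator (cball 0 R) x * (W x * (A * envelope (DIM('a) - 1) \<alpha> (norm x)) powr \<tau>)) \<partial>lebesgue)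
     \<le> (\<integral>\<^sup>+x. ennreal (?h x) \<partial>lebesgue)"
    by (intro nn_integral_mono ennreal_leI pt)
  also have "\<dots> < \<infinity>" using i unfolding nn_integral_completion real_integrable_def by (simp add: less_top)
  finally show ?thesis .
qed

lemma tail_pointwise:
  fixes v w x \<delta> A C :: real
  assumes x: "1 < x" and \<tau>: "2 < \<tau>b" "\<tau>b \<le> \<tau>" and w: "\<bar>w\<bar> \<le> A * x powr (- real n / 2)" and A: "0 < A" and C: "0 < C"
    and v: "0 \<le> v" and \<delta>: "0 \<le> p" "p \<le> \<delta>"
    and W: "W \<le> C * p * v * x powr (real n * (\<tau>b - 2) / 2)"
  shows "W * \<bar>w\<bar> powr \<tau> \<le> C * \<delta> * A powr (\<tau> - 2) * (v * w\<^sup>2)"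
proof -
  have d: "0 \<le> \<delta>" using \<delta> by linarith
  define q where "q = real n * (\<tau>b - 2) / 2"
  have wt: "\<bar>w\<bar> powr \<tau> = \<bar>w\<bar> powr (\<tau> - 2) * w\<^sup>2"
  proof (cases "w = 0")
    case False
    have "\<bar>w\<bar> powr \<tau> = \<bar>w\<bar> powr ((\<tau> - 2) + 2)" by simp
    also have "\<dots> = \<bar>w\<bar> powr (\<tau> - 2) * \<bar>w\<bar> powr 2" by (rule powr_add)
    also have "\<bar>w\<bar> powr 2 = w\<^sup>2" using False by simp
    finally show ?thesis .
  qed simp
  have "\<bar>w\<bar> powr (\<tau> - 2) \<le> (A * x powr (- real n / 2)) powr (\<tau> - 2)"
    using w \<tau> by (intro powr_mono2) auto
  also have "\<dots> = A powr (\<tau> - 2) * x powr (- real n / 2 * (\<tau> - 2))"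
    using A by (simp add: powr_mult powr_powr)
  finally have 1: "\<bar>w\<bar> powr (\<tau> - 2) \<le> A powr (\<tau> - 2) * x powr (- real n / 2 * (\<tau> - 2))" .
  have 2: "x powr q * x powr (- real n / 2 * (\<tau> - 2)) \<le> 1"
  proof -
    have "real n * (\<tau>b - \<tau>) \<le> 0" using \<tau> by (intro mult_nonneg_nonpos) auto
    then have "q + (- real n / 2 * (\<tau> - 2)) \<le> 0" by (simp add: q_def field_simps)
    then have "x powr (q + (- real n / 2 * (\<tau> - 2))) \<le> x powr 0" using x by (intro powr_mono) auto
    then show ?thesis using x by (simp only: powr_add powr_zero_eq_one split: if_splits)
  qed
  have W': "W \<le> C * \<delta> * v * x powr q"
  proof -
    have "C * p * v * x powr q \<le> C * \<delta> * v * x powr q"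
      using C \<delta> v by (intro mult_right_mono mult_left_mono) auto
    then show ?thesis using W unfolding q_def by linarith
  qed
  have "W * \<bar>w\<bar> powr \<tau> \<le> (C * \<delta> * v * x powr q) * \<bar>w\<bar> powr \<tau>"
    using W' by (rule mult_right_mono) simp
  also have "\<dots> = C * \<delta> * (v * w\<^sup>2) * (x powr q * \<bar>w\<bar> powr (\<tau> - 2))" unfolding wt by (simp add: mult_ac)
  also have "\<dots> \<le> C * \<delta> * (v * w\<^sup>2) * (x powr q * (A powr (\<tau> - 2) * x powr (- real n / 2 * (\<tau> - 2))))"
    using C d v 1 by (intro mult_left_mono) auto
  also have "\<dots> = C * \<delta> * (v * w\<^sup>2) * A powr (\<tau> - 2) * (x powr q * x powr (- real n / 2 * (\<tau> - 2)))"
    by (simp add: mult_ac)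
  also have "\<dots> \<le> C * \<delta> * (v * w\<^sup>2) * A powr (\<tau> - 2) * 1"
    using C d v 2 by (intro mult_left_mono) auto
  finally show ?thesis by (simp add: mult_ac)
qed

lemma ennreal_tendsto_0I:
  fixes f :: "nat \<Rightarrow> ennreal"
  assumes "\<And>e. 0 < e \<Longrightarrow> \<forall>\<^sub>F k in sequentially. f k \<le> ennreal e"
  shows "f \<longlonglongrightarrow> 0"
proof (rule order_tendstoI)
  fix a :: ennreal assume "0 < a"
  then obtain b where b: "0 < b" "b < a" using dense by blast
  then obtain e where e: "b = ennreal e" "0 < e" by (cases b) auto
  show "\<forall>\<^sub>F k in sequentially. f k < a"
    using assms[OF e(2)] by eventually_elim (use b(2) e(1) in auto)
qed simp

locale radial_embedding =
  fixes V W \<phi> :: "'a::euclidean_space \<Rightarrow> real" and \<tau>b R C c0 \<tau> \<alpha> :: real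
  assumes contV: "continuous_on UNIV V" and contW: "continuous_on UNIV W"
    and V_ge: "\<And>x. c0 \<le> V x" and c0: "0 < c0" and W_nonneg: "\<And>x. 0 \<le> W x"
    and \<phi>_nonneg: "\<And>x. 0 \<le> \<phi> x" and \<phi>_lim: "(\<phi> \<longlongrightarrow> 0) at_infinity"
    and \<tau>b: "2 < \<tau>b" "\<tau>b \<le> \<tau>" and C_pos: "0 < C"
    and W_le: "\<And>x. R \<le> norm x \<Longrightarrow> W x \<le> C * \<phi> x * V x * norm x powr (real (DIM('a) - 1) * (\<tau>b - 2) / 2)"
    and \<alpha>: "0 < \<alpha>" "real DIM('a) - 2 \<le> 2 * \<alpha>" "\<alpha> * \<tau> < real DIM('a)"
begin

abbreviation env :: "'a \<Rightarrow> real" where "env x \<equiv> envelope (DIM('a) - 1) \<alpha> (norm x)"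

definition admissible :: "real \<Rightarrow> real \<Rightarrow> ('a \<Rightarrow> real) \<Rightarrow> bool" where
  "admissible A Q w \<longleftrightarrow> w \<in> borel_measurable lebesgue \<and> (AE x in lebesgue. \<bar>w x\<bar> \<le> A * env x) \<and>
     (\<integral>\<^sup>+ x. ennreal (V x * (w x)\<^sup>2) \<partial>lebesgue) \<le> ennreal Q"

lemma V_nonneg: "0 \<le> V x" using V_ge[of x] c0 by linarith

lemma V_measurable [measurable]: "V \<in> borel_measurable lebesgue"
  using borel_measurable_continuous_onI[OF contV] by (intro measurable_completion) simp

lemma W_measurable [measurable]: "W \<in> borel_measurable lebesgue"
  using borel_measurable_continuous_onI[OF contW] by (intro measurable_completion) simp

lemma env_measurable [measurable]: "env \<in> borel_measurable lebesgue"
  by (intro measurable_completion) measurable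

lemma cball_measurable [measurable]: "cball (0::'a) r \<in> sets lebesgue"
  by (intro sets_completionI_sets) auto

lemma tail_small:
  assumes A: "0 < A" and Q: "0 \<le> Q" and \<epsilon>: "0 < \<epsilon>"
  obtains r where "\<And>w. admissible A Q w \<Longrightarrow>
    (\<integral>\<^sup>+ x. ennreal (indicator (- cball 0 r) x * (W x * \<bar>w x\<bar> powr \<tau>)) \<partial>lebesgue) \<le> ennreal \<epsilon>"
proof -
  define D where "D = C * A powr (\<tau> - 2)"
  have D: "0 < D" using C_pos A by (simp add: D_def)
  define \<delta> where "\<delta> = \<epsilon> / (D * (Q + 1))"
  have \<delta>: "0 < \<delta>" using \<epsilon> D Q by (simp add: \<delta>_def)
  have "\<forall>\<^sub>F x in at_infinity. dist (\<phi> x) 0 < \<delta>" using \<phi>_lim \<delta> by (rule tendstoD)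
  then obtain b where b: "\<And>x. b \<le> norm x \<Longrightarrow> \<phi> x < \<delta>"
    unfolding eventually_at_infinity by (auto simp: \<phi>_nonneg)
  define r where "r = max 1 (max b R)"
  have "(\<integral>\<^sup>+ x. ennreal (indicator (- cball 0 r) x * (W x * \<bar>w x\<bar> powr \<tau>)) \<partial>lebesgue) \<le> ennreal \<epsilon>"
    if w: "admissible A Q w" for w
  proof -
    have [measurable]: "w \<in> borel_measurable lebesgue" using w by (simp add: admissible_def)
    have "AE x in lebesgue. \<bar>w x\<bar> \<le> A * env x" using w by (simp add: admissible_def)
    then have "AE x in lebesgue. ennreal (indicator (- cball 0 r) x * (W x * \<bar>w x\<bar> powr \<tau>))
        \<le> ennreal (D * \<delta>) * ennreal (V x * (w x)\<^sup>2)"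
    proof eventually_elim
      case (elim x)
      have "indicator (- cball 0 r) x * (W x * \<bar>w x\<bar> powr \<tau>) \<le> D * \<delta> * (V x * (w x)\<^sup>2)"
      proof (cases "x \<in> cball 0 r")
        case True
        then show ?thesis using D \<delta> V_nonneg[of x] by simp
      next
        case False
        then have x: "1 < norm x" "b \<le> norm x" "R \<le> norm x" by (auto simp: r_def)
        have "W x * \<bar>w x\<bar> powr \<tau> \<le> C * \<delta> * A powr (\<tau> - 2) * (V x * (w x)\<^sup>2)"
          by (rule tail_pointwise[OF x(1) \<tau>b _ A C_pos V_nonneg \<phi>_nonneg less_imp_le[OF b[OF x(2)]] W_le[OF x(3)]])
            (use elim x(1) in \<open>simp add: envelope_def\<close>)
        then show ?thesis using False by (simp add: D_def mult_ac)
      qed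
      then show ?case using D \<delta> V_nonneg[of x] by (simp add: ennreal_mult[symmetric] ennreal_leI)
    qed
    then have "(\<integral>\<^sup>+ x. ennreal (indicator (- cball 0 r) x * (W x * \<bar>w x\<bar> powr \<tau>)) \<partial>lebesgue)
       \<le> (\<integral>\<^sup>+ x. ennreal (D * \<delta>) * ennreal (V x * (w x)\<^sup>2) \<partial>lebesgue)"
      by (rule nn_integral_mono_AE)
    also have "\<dots> = ennreal (D * \<delta>) * (\<integral>\<^sup>+ x. ennreal (V x * (w x)\<^sup>2) \<partial>lebesgue)"
      by (rule nn_integral_cmult) measurable
    also have "\<dots> \<le> ennreal (D * \<delta>) * ennreal Q" using w by (intro mult_left_mono) (auto simp: admissible_def)
    also have "\<dots> = ennreal (D * \<delta> * Q)" using D \<delta> Q by (simp add: ennreal_mult)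
    also have "\<dots> \<le> ennreal \<epsilon>"
    proof (rule ennreal_leI)
      have "D * \<delta> * Q = \<epsilon> * (Q / (Q + 1))" using D Q by (simp add: \<delta>_def)
      also have "\<dots> \<le> \<epsilon> * 1" using Q \<epsilon> by (intro mult_left_mono) (auto simp: divide_le_eq_1)
      finally show "D * \<delta> * Q \<le> \<epsilon>" by simp
    qed
    finally show ?thesis .
  qed
  then show ?thesis by (rule that)
qed

lemma nn_integral_split_ball:
  assumes [measurable]: "w \<in> borel_measurable lebesgue"
  shows "(\<integral>\<^sup>+ x. ennreal (W x * \<bar>w x\<bar> powr \<tau>) \<partial>lebesgue) =
    (\<integral>\<^sup>+ x. ennreal (indicator (cball 0 r) x * (W x * \<bar>w x\<bar> powr \<tau>)) \<partial>lebesgue) +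
    (\<integral>\<^sup>+ x. ennreal (indicator (- cball 0 r) x * (W x * \<bar>w x\<bar> powr \<tau>)) \<partial>lebesgue)"
proof -
  have "(\<integral>\<^sup>+ x. ennreal (W x * \<bar>w x\<bar> powr \<tau>) \<partial>lebesgue) =
    (\<integral>\<^sup>+ x. ennreal (indicator (cball 0 r) x * (W x * \<bar>w x\<bar> powr \<tau>)) + ennreal (indicator (- cball 0 r) x * (W x * \<bar>w x\<bar> powr \<tau>)) \<partial>lebesgue)"
    by (intro nn_integral_cong) (auto simp: indicator_def)
  also have "\<dots> = (\<integral>\<^sup>+ x. ennreal (indicator (cball 0 r) x * (W x * \<bar>w x\<bar> powr \<tau>)) \<partial>lebesgue) +
    (\<integral>\<^sup>+ x. ennreal (indicator (- cball 0 r) x * (W x * \<bar>w x\<bar> powr \<tau>)) \<partial>lebesgue)"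
    by (rule nn_integral_add) measurable
  finally show ?thesis .
qed

lemma ball_dominated:
  assumes "\<bar>w x\<bar> \<le> A * env x"
  shows "ennreal (indicator (cball 0 r) x * (W x * \<bar>w x\<bar> powr \<tau>)) \<le> ennreal (indicator (cball 0 r) x * (W x * (A * env x) powr \<tau>))"
proof -
  have "\<bar>w x\<bar> powr \<tau> \<le> (A * env x) powr \<tau>" using assms \<tau>b by (intro powr_mono2) auto
  then show ?thesis using W_nonneg[of x] by (intro ennreal_leI mult_left_mono) auto
qed

lemma ball_envelope_finite:
  "0 \<le> A \<Longrightarrow> (\<integral>\<^sup>+ x. ennreal (indicator (cball 0 r) x * (W x * (A * env x) powr \<tau>)) \<partial>lebesgue) < \<infinity>"
  using \<alpha> \<tau>b by (intro envelope_ball_finite contW) auto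

lemma admissible_LW:
  assumes A: "0 < A" and Q: "0 \<le> Q" and w: "admissible A Q w"
  shows "w \<in> LW W \<tau>"
proof -
  have [measurable]: "w \<in> borel_measurable lebesgue" using w by (simp add: admissible_def)
  obtain r where r: "\<And>w. admissible A Q w \<Longrightarrow>
    (\<integral>\<^sup>+ x. ennreal (indicator (- cball 0 r) x * (W x * \<bar>w x\<bar> powr \<tau>)) \<partial>lebesgue) \<le> ennreal 1"
    using tail_small[OF A Q, of 1] by auto
  have "AE x in lebesgue. \<bar>w x\<bar> \<le> A * env x" using w by (simp add: admissible_def)
  then have "(\<integral>\<^sup>+ x. ennreal (indicator (cball 0 r) x * (W x * \<bar>w x\<bar> powr \<tau>)) \<partial>lebesgue)
     \<le> (\<integral>\<^sup>+ x. ennreal (indicator (cball 0 r) x * (W x * (A * env x) powr \<tau>)) \<partial>lebesgue)"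
    by (intro nn_integral_mono_AE) (erule eventually_mono, rule ball_dominated)
  also have "\<dots> < \<infinity>" using A by (intro ball_envelope_finite) simp
  finally have "(\<integral>\<^sup>+ x. ennreal (W x * \<bar>w x\<bar> powr \<tau>) \<partial>lebesgue) < \<infinity>"
    using order_le_less_trans[OF r[OF w], of \<infinity>]
    unfolding nn_integral_split_ball[OF \<open>w \<in> borel_measurable lebesgue\<close>, of r] by simp
  then show ?thesis by (simp add: LW_def)
qed

lemma admissible_tendsto_0:
  assumes A: "0 < A" and Q: "0 \<le> Q" and w: "\<And>k. admissible A Q (w k)"
    and lim: "AE x in lebesgue. (\<lambda>k. w k x) \<longlonglongrightarrow> 0"
  shows "(\<lambda>k. \<integral>\<^sup>+ x. ennreal (W x * \<bar>w k x\<bar> powr \<tau>) \<partial>lebesgue) \<longlonglongrightarrow> 0"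
proof (rule ennreal_tendsto_0I)
  fix e :: real assume e: "0 < e"
  have wm[measurable]: "w k \<in> borel_measurable lebesgue" for k using w by (simp add: admissible_def)
  obtain r where r: "\<And>w. admissible A Q w \<Longrightarrow>
    (\<integral>\<^sup>+ x. ennreal (indicator (- cball 0 r) x * (W x * \<bar>w x\<bar> powr \<tau>)) \<partial>lebesgue) \<le> ennreal (e / 2)"
    using tail_small[OF A Q, of "e / 2"] e by auto
  have "(\<lambda>k. \<integral>\<^sup>+ x. ennreal (indicator (cball 0 r) x * (W x * \<bar>w k x\<bar> powr \<tau>)) \<partial>lebesgue) \<longlonglongrightarrow> (\<integral>\<^sup>+ (x::'a). 0 \<partial>lebesgue)"
  proof (rule nn_integral_dominated_convergence)
    show "(\<integral>\<^sup>+ x. ennreal (indicator (cball 0 r) x * (W x * (A * env x) powr \<tau>)) \<partial>lebesgue) < \<infinity>"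
      using A by (intro ball_envelope_finite) simp
    show "AE x in lebesgue. ennreal (indicator (cball 0 r) x * (W x * \<bar>w k x\<bar> powr \<tau>))
      \<le> ennreal (indicator (cball 0 r) x * (W x * (A * env x) powr \<tau>))" for k
    proof -
      have "AE x in lebesgue. \<bar>w k x\<bar> \<le> A * env x" using w[of k] by (simp add: admissible_def)
      then show ?thesis by eventually_elim (rule ball_dominated)
    qed
    show "AE x in lebesgue. (\<lambda>k. ennreal (indicator (cball 0 r) x * (W x * \<bar>w k x\<bar> powr \<tau>))) \<longlonglongrightarrow> 0"
      using lim
    proof eventually_elim
      case (elim x)
      have "(\<lambda>k. \<bar>w k x\<bar> powr \<tau>) \<longlonglongrightarrow> 0 powr \<tau>"
        using tendsto_rabs[OF elim] \<tau>b by (intro tendsto_powr2 tendsto_const) auto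
      then have "(\<lambda>k. indicator (cball 0 r) x * (W x * \<bar>w k x\<bar> powr \<tau>)) \<longlonglongrightarrow> indicator (cball 0 r) x * (W x * 0 powr \<tau>)"
        by (intro tendsto_mult_left)
      then have "(\<lambda>k. ennreal (indicator (cball 0 r) x * (W x * \<bar>w k x\<bar> powr \<tau>))) \<longlonglongrightarrow> ennreal (indicator (cball 0 r) x * (W x * 0 powr \<tau>))"
        by (rule tendsto_ennrealI)
      then show ?case by simp
    qed
  qed measurable
  then have "(\<lambda>k. \<integral>\<^sup>+ x. ennreal (indicator (cball 0 r) x * (W x * \<bar>w k x\<bar> powr \<tau>)) \<partial>lebesgue) \<longlonglongrightarrow> 0" by simp
  from order_tendstoD(2)[OF this, of "ennreal (e / 2)"] e
  have "\<forall>\<^sub>F k in sequentially. (\<integral>\<^sup>+ x. ennreal (indicator (cball 0 r) x * (W x * \<bar>w k x\<bar> powr \<tau>)) \<partial>lebesgue) < ennreal (e / 2)"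
    by simp
  then show "\<forall>\<^sub>F k in sequentially. (\<integral>\<^sup>+ x. ennreal (W x * \<bar>w k x\<bar> powr \<tau>) \<partial>lebesgue) \<le> ennreal e"
  proof eventually_elim
    case (elim k)
    have "(\<integral>\<^sup>+ x. ennreal (W x * \<bar>w k x\<bar> powr \<tau>) \<partial>lebesgue) \<le> ennreal (e / 2) + ennreal (e / 2)"
      unfolding nn_integral_split_ball[OF wm, of k r] using elim r[OF w[of k]] by (intro add_mono) auto
    also have "\<dots> = ennreal e" using e by (simp flip: ennreal_plus)
    finally show ?case .
  qed
qed

end

lemma radial_profiles_subsequence:
  fixes U :: "nat \<Rightarrow> real \<Rightarrow> real"
  assumes bdd: "\<And>k r. 0 < r \<Longrightarrow> \<bar>U k r\<bar> \<le> b r"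
    and equi: "\<And>k r s. 0 < r \<Longrightarrow> r \<le> s \<Longrightarrow> \<bar>U k r - U k s\<bar> \<le> sqrt (h r * (s - r))"
    and h: "\<And>r. 0 < r \<Longrightarrow> 0 \<le> h r"
  obtains \<sigma> where "strict_mono \<sigma>" "\<And>r. 0 < r \<Longrightarrow> convergent (\<lambda>k. U (\<sigma> k) r)"
proof -
  define S :: "real set" where "S = {r \<in> \<rat>. 0 < r}"
  have S: "countable S" unfolding S_def by (rule countable_subset[OF _ countable_rat]) auto
  have "norm (U k r / (b r + 1)) \<le> 1" if "r \<in> S" for k r
  proof -
    have "\<bar>U k r\<bar> \<le> b r" using that bdd by (simp add: S_def)
    moreover from this have "0 < b r + 1" by linarith
    ultimately show ?thesis by simp
  qed
  then obtain \<sigma> where \<sigma>: "strict_mono (\<sigma> :: nat \<Rightarrow> nat)"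
    and l: "\<And>r. r \<in> S \<Longrightarrow> \<exists>l. (\<lambda>k. U (\<sigma> k) r / (b r + 1)) \<longlonglongrightarrow> l"
    using function_convergent_subsequence[OF S, of "\<lambda>k r. U k r / (b r + 1)" 1] by blast
  have cS: "Cauchy (\<lambda>k. U (\<sigma> k) q)" if q: "q \<in> S" for q
  proof -
    obtain l where "(\<lambda>k. U (\<sigma> k) q / (b q + 1)) \<longlonglongrightarrow> l" using l[OF q] by blast
    from tendsto_mult_right[OF this, of "b q + 1"]
    have "(\<lambda>k. U (\<sigma> k) q / (b q + 1) * (b q + 1)) \<longlonglongrightarrow> l * (b q + 1)" .
    moreover have "b q + 1 \<noteq> 0" using bdd[of q 0] q by (auto simp: S_def)
    ultimately show ?thesis by (simp add: LIMSEQ_imp_Cauchy)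
  qed
  have "convergent (\<lambda>k. U (\<sigma> k) r)" if r: "0 < r" for r
  proof (rule Cauchy_convergent, rule CauchyI)
    fix e :: real assume e: "0 < e"
    define d where "d = (e / 3)\<^sup>2 / (h r + 1)"
    have d: "0 < d" using e h[OF r] by (simp add: d_def)
    obtain q where q: "q \<in> \<rat>" "r < q" "q < r + d" using Rats_dense_in_real[of r "r + d"] d by auto
    then have qS: "q \<in> S" using r by (simp add: S_def)
    have close: "\<bar>U k r - U k q\<bar> \<le> e / 3" for k
    proof -
      have "h r * (q - r) \<le> (h r + 1) * d" using q h[OF r] by (intro mult_mono) auto
      also have "\<dots> = (e / 3)\<^sup>2" using h[OF r] by (simp add: d_def)
      finally have "sqrt (h r * (q - r)) \<le> e / 3" using e by (intro real_le_lsqrt) auto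
      then show ?thesis using equi[OF r, of q k] q(2) by linarith
    qed
    obtain K where K: "\<And>m n. K \<le> m \<Longrightarrow> K \<le> n \<Longrightarrow> norm (U (\<sigma> m) q - U (\<sigma> n) q) < e / 3"
      using CauchyD[OF cS[OF qS], of "e / 3"] e by auto
    have "norm (U (\<sigma> m) r - U (\<sigma> n) r) < e" if "K \<le> m" "K \<le> n" for m n
      using K[OF that] close[of "\<sigma> m"] close[of "\<sigma> n"] unfolding real_norm_def by linarith
    then show "\<exists>K. \<forall>m\<ge>K. \<forall>n\<ge>K. norm (U (\<sigma> m) r - U (\<sigma> n) r) < e" by blast
  qed
  with \<sigma> show ?thesis by (rule that)
qed

context radial_embedding
begin

lemma compact_embedding: "compact_embedding_rad V W \<tau>"
proof -
  define n where "n = DIM('a) - 1"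
  obtain B where B: "0 < B" and env: "\<And>(f::'a \<Rightarrow> real) H r. C1c f \<Longrightarrow> (\<integral>x. grad_sq f x \<partial>lborel) \<le> H\<^sup>2 \<Longrightarrow>
      (\<integral>x. (f x)\<^sup>2 \<partial>lborel) \<le> H\<^sup>2 \<Longrightarrow> 0 \<le> H \<Longrightarrow> 0 < r \<Longrightarrow> \<bar>sph_mean f r\<bar> \<le> B * H * envelope (DIM('a) - 1) \<alpha> r"
    using sph_mean_envelope[where 'a = 'a, OF \<alpha>(1,2)] by blast
  define c where "c = sphere_area TYPE('a)"
  have c: "0 < c" unfolding c_def by (rule sphere_area_pos)
  define HM where "HM = (\<lambda>M::real. sqrt (max 1 (1 / c0) * M\<^sup>2) + 1)"
  have \<kappa>: "0 \<le> max 1 (1 / c0) * M\<^sup>2" for M by simp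
  have HM1: "0 < HM M" for M using real_sqrt_ge_zero[OF \<kappa>[of M]] unfolding HM_def by linarith
  have HM2: "max 1 (1 / c0) * M\<^sup>2 \<le> (HM M)\<^sup>2" for M
  proof -
    have "max 1 (1 / c0) * M\<^sup>2 = (sqrt (max 1 (1 / c0) * M\<^sup>2))\<^sup>2" using real_sqrt_pow2[OF \<kappa>] by simp
    also have "\<dots> \<le> (HM M)\<^sup>2" unfolding HM_def by (intro power_mono real_sqrt_ge_zero \<kappa>) simp
    finally show ?thesis .
  qed
  have profile: "\<exists>U. U \<in> borel_measurable borel \<and> (AE x in lebesgue. u x = U (norm x)) \<and>
      (\<forall>r>0. \<bar>U r\<bar> \<le> B * HM M * envelope n \<alpha> r) \<and>
      (\<forall>r s. 0 < r \<longrightarrow> r \<le> s \<longrightarrow> \<bar>U r - U s\<bar> \<le> sqrt ((HM M)\<^sup>2 * ((s - r) / r ^ n) / c)) \<and>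
      (\<integral>\<^sup>+ x. ennreal (V x * (u x)\<^sup>2) \<partial>lebesgue) \<le> 2 * ennreal (M\<^sup>2)"
    if u: "radial u" "H1V_bounded_by V M u" for u M
    by (rule H1V_radial_profile[OF contV V_ge c0 \<alpha>(1) env B u less_imp_le[OF HM1[of M]] HM2[of M]])
      (assumption | (unfold n_def c_def, blast))+
  have nz: "AE x in lebesgue. 0 < norm (x::'a)"
  proof -
    have "{0::'a} \<in> null_sets lebesgue" by (simp add: null_sets_completion_iff)
    then show ?thesis by (rule AE_I') auto
  qed
  have A: "0 < B * HM M" for M using B HM1 by simp
  have two: "2 * ennreal (M\<^sup>2) = ennreal (2 * M\<^sup>2)" for M by (simp add: ennreal_mult')

  have adm: "admissible (B * HM M) (2 * M\<^sup>2) u" if u: "radial u" "H1V_bounded_by V M u" for u M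
  proof -
    obtain U where U: "AE x in lebesgue. u x = U (norm x)" "\<forall>r>0. \<bar>U r\<bar> \<le> B * HM M * envelope n \<alpha> r"
      "(\<integral>\<^sup>+ x. ennreal (V x * (u x)\<^sup>2) \<partial>lebesgue) \<le> 2 * ennreal (M\<^sup>2)"
      using profile[OF u] by blast
    have "AE x in lebesgue. \<bar>u x\<bar> \<le> B * HM M * env x"
      using U(1) nz by eventually_elim (use U(2) in \<open>simp add: n_def\<close>)
    then show ?thesis using U(3) u(2) unfolding admissible_def two by (simp add: H1V_bounded_by_def)
  qed
  have sub: "H1V_rad V \<subseteq> LW_rad W \<tau>"
  proof
    fix u assume u: "u \<in> H1V_rad V"
    then obtain M where M: "H1V_bounded_by V M u"
      using H1V_imp_bounded[OF _ contV V_nonneg] by (auto simp: H1V_rad_def)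
    have r: "radial u" using u by (simp add: H1V_rad_def)
    have "u \<in> LW W \<tau>" using admissible_LW[OF A _ adm[OF r M]] by simp
    with r show "u \<in> LW_rad W \<tau>" by (simp add: LW_rad_def)
  qed
  have "\<exists>\<sigma> v. strict_mono \<sigma> \<and> v \<in> LW_rad W \<tau> \<and>
     ((\<lambda>k. \<integral>\<^sup>+ x. ennreal (W x * \<bar>u (\<sigma> k) x - v x\<bar> powr \<tau>) \<partial>lebesgue) \<longlonglongrightarrow> 0)"
    if u: "\<forall>k. u k \<in> H1V_rad V \<and> H1V_bounded_by V M (u k)" for u :: "nat \<Rightarrow> 'a \<Rightarrow> real" and M
  proof -
    define H where "H = HM M"
    have rad: "radial (u k)" for k using u by (simp add: H1V_rad_def)
    have um[measurable]: "u k \<in> borel_measurable lebesgue" for k using u by (simp add: H1V_bounded_by_def)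
    have "\<forall>k. \<exists>U. U \<in> borel_measurable borel \<and> (AE x in lebesgue. u k x = U (norm x)) \<and>
      (\<forall>r>0. \<bar>U r\<bar> \<le> B * H * envelope n \<alpha> r) \<and>
      (\<forall>r s. 0 < r \<longrightarrow> r \<le> s \<longrightarrow> \<bar>U r - U s\<bar> \<le> sqrt (H\<^sup>2 * ((s - r) / r ^ n) / c)) \<and>
      (\<integral>\<^sup>+ x. ennreal (V x * (u k x)\<^sup>2) \<partial>lebesgue) \<le> 2 * ennreal (M\<^sup>2)"
      unfolding H_def using profile rad u by blast
    from choice[OF this] obtain U where all: "\<forall>k. U k \<in> borel_measurable borel \<and> (AE x in lebesgue. u k x = U k (norm x)) \<and>
      (\<forall>r>0. \<bar>U k r\<bar> \<le> B * H * envelope n \<alpha> r) \<and>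
      (\<forall>r s. 0 < r \<longrightarrow> r \<le> s \<longrightarrow> \<bar>U k r - U k s\<bar> \<le> sqrt (H\<^sup>2 * ((s - r) / r ^ n) / c)) \<and>
      (\<integral>\<^sup>+ x. ennreal (V x * (u k x)\<^sup>2) \<partial>lebesgue) \<le> 2 * ennreal (M\<^sup>2)" by (elim exE)
    have U: "U k \<in> borel_measurable borel" for k using all by blast
    have uU: "AE x in lebesgue. u k x = U k (norm x)" for k using all by blast
    have Ub: "\<bar>U k r\<bar> \<le> B * H * envelope n \<alpha> r" if "0 < r" for k r using all that by blast
    have Uh: "\<bar>U k r - U k s\<bar> \<le> sqrt (H\<^sup>2 * ((s - r) / r ^ n) / c)" if "0 < r" "r \<le> s" for k r s
      using all that by blast
    have uV: "(\<integral>\<^sup>+ x. ennreal (V x * (u k x)\<^sup>2) \<partial>lebesgue) \<le> 2 * ennreal (M\<^sup>2)" for k using all by blast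
    obtain \<sigma> where \<sigma>: "strict_mono \<sigma>" and conv: "\<And>r. 0 < r \<Longrightarrow> convergent (\<lambda>k. U (\<sigma> k) r)"
    proof (rule radial_profiles_subsequence[of U "\<lambda>r. B * H * envelope n \<alpha> r" "\<lambda>r. H\<^sup>2 / r ^ n / c"])
      show "\<bar>U k r - U k s\<bar> \<le> sqrt (H\<^sup>2 / r ^ n / c * (s - r))" if "0 < r" "r \<le> s" for k r s
        using Uh[OF that, of k] by (simp add: mult_ac)
    qed (use Ub c that in auto)
    define F where "F = (\<lambda>k r. if 0 < r then U (\<sigma> k) r else 0)"
    define L where "L = (\<lambda>r. if 0 < r then lim (\<lambda>k. U (\<sigma> k) r) else 0)"
    have FL: "(\<lambda>k. F k r) \<longlonglongrightarrow> L r" for r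
      using conv[of r] by (auto simp: F_def L_def convergent_LIMSEQ_iff)
    have Fm: "F k \<in> borel_measurable borel" for k unfolding F_def using U[of "\<sigma> k"] by measurable
    have Lm[measurable]: "L \<in> borel_measurable borel" by (rule borel_measurable_LIMSEQ_real[OF FL Fm])
    define v where "v = (\<lambda>x::'a. L (norm x))"
    have vm[measurable]: "v \<in> borel_measurable lebesgue"
      unfolding v_def by (intro measurable_completion) measurable
    have vr: "radial v" by (simp add: v_def radial_def)
    have Lb: "\<bar>L r\<bar> \<le> B * H * envelope n \<alpha> r" if "0 < r" for r
      using tendsto_rabs[OF FL[of r]] Ub[OF that] that by (intro LIMSEQ_le_const2) (auto simp: F_def)
    have "AE x in lebesgue. \<forall>k. u k x = U k (norm x)" using uU by (simp add: AE_all_countable)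
    then have lim: "AE x in lebesgue. (\<lambda>k. u (\<sigma> k) x) \<longlonglongrightarrow> v x"
      using nz
    proof eventually_elim
      case (elim x)
      then show ?case using FL[of "norm x"] by (simp add: F_def v_def)
    qed
    have vV: "(\<integral>\<^sup>+ x. ennreal (V x * (v x)\<^sup>2) \<partial>lebesgue) \<le> 2 * ennreal (M\<^sup>2)"
    proof -
      have "AE x in lebesgue. ennreal (V x * (v x)\<^sup>2) = liminf (\<lambda>k. ennreal (V x * (u (\<sigma> k) x)\<^sup>2))"
        using lim
      proof eventually_elim
        case (elim x)
        then have "(\<lambda>k. ennreal (V x * (u (\<sigma> k) x)\<^sup>2)) \<longlonglongrightarrow> ennreal (V x * (v x)\<^sup>2)"
          by (intro tendsto_ennrealI tendsto_mult_left tendsto_power)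
        then show ?case using lim_imp_Liminf[OF sequentially_bot] by metis
      qed
      then have "(\<integral>\<^sup>+ x. ennreal (V x * (v x)\<^sup>2) \<partial>lebesgue) = (\<integral>\<^sup>+ x. liminf (\<lambda>k. ennreal (V x * (u (\<sigma> k) x)\<^sup>2)) \<partial>lebesgue)"
        by (rule nn_integral_cong_AE)
      also have "\<dots> \<le> liminf (\<lambda>k. \<integral>\<^sup>+ x. ennreal (V x * (u (\<sigma> k) x)\<^sup>2) \<partial>lebesgue)"
        by (rule nn_integral_liminf) measurable
      also have "\<dots> \<le> liminf (\<lambda>k::nat. 2 * ennreal (M\<^sup>2))"
        using uV by (intro Liminf_mono always_eventually allI)
      also have "\<dots> = 2 * ennreal (M\<^sup>2)" by (simp add: Liminf_const)
      finally show ?thesis .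
    qed
    have vb: "AE x in lebesgue. \<bar>v x\<bar> \<le> B * H * env x"
      using nz by eventually_elim (use Lb in \<open>simp add: v_def n_def\<close>)
    have "admissible (B * H) (2 * M\<^sup>2) v" unfolding admissible_def using vm vb vV two by simp
    then have vL: "v \<in> LW_rad W \<tau>" using admissible_LW[OF A[of M], of "2 * M\<^sup>2" v] vr by (simp add: LW_rad_def H_def)
    have "admissible (2 * (B * H)) (8 * M\<^sup>2) (\<lambda>x. u (\<sigma> k) x - v x)" for k
      unfolding admissible_def
    proof (intro conjI)
      have au: "admissible (B * H) (2 * M\<^sup>2) (u (\<sigma> k))" unfolding H_def using adm rad u by blast
      then have "AE x in lebesgue. \<bar>u (\<sigma> k) x\<bar> \<le> B * H * env x" by (simp add: admissible_def)
      then show "AE x in lebesgue. \<bar>u (\<sigma> k) x - v x\<bar> \<le> 2 * (B * H) * env x"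
        using vb
      proof eventually_elim
        case (elim x)
        have "\<bar>u (\<sigma> k) x - v x\<bar> \<le> \<bar>u (\<sigma> k) x\<bar> + \<bar>v x\<bar>" by (rule abs_triangle_ineq4)
        then show ?case using elim by linarith
      qed
      have pt: "ennreal (V x * (u (\<sigma> k) x - v x)\<^sup>2) \<le> 2 * ennreal (V x * (u (\<sigma> k) x)\<^sup>2) + 2 * ennreal (V x * (v x)\<^sup>2)" for x
      proof -
        have "(a - b)\<^sup>2 \<le> 2 * a\<^sup>2 + 2 * b\<^sup>2" for a b :: real
          using zero_le_power2[of "a + b"] by (simp add: power2_eq_square algebra_simps)
        then have "V x * (u (\<sigma> k) x - v x)\<^sup>2 \<le> V x * (2 * (u (\<sigma> k) x)\<^sup>2 + 2 * (v x)\<^sup>2)"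
          using V_nonneg by (rule mult_left_mono)
        then have "ennreal (V x * (u (\<sigma> k) x - v x)\<^sup>2) \<le> ennreal (2 * (V x * (u (\<sigma> k) x)\<^sup>2) + 2 * (V x * (v x)\<^sup>2))"
          by (intro ennreal_leI) (simp add: algebra_simps)
        also have "\<dots> = 2 * ennreal (V x * (u (\<sigma> k) x)\<^sup>2) + 2 * ennreal (V x * (v x)\<^sup>2)"
          using V_nonneg[of x] by (simp add: ennreal_mult')
        finally show ?thesis .
      qed
      have "(\<integral>\<^sup>+ x. ennreal (V x * (u (\<sigma> k) x - v x)\<^sup>2) \<partial>lebesgue)
         \<le> (\<integral>\<^sup>+ x. 2 * ennreal (V x * (u (\<sigma> k) x)\<^sup>2) + 2 * ennreal (V x * (v x)\<^sup>2) \<partial>lebesgue)"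
        by (rule nn_integral_mono) (rule pt)
      also have "\<dots> = 2 * (\<integral>\<^sup>+ x. ennreal (V x * (u (\<sigma> k) x)\<^sup>2) \<partial>lebesgue) + 2 * (\<integral>\<^sup>+ x. ennreal (V x * (v x)\<^sup>2) \<partial>lebesgue)"
        by (subst nn_integral_add) (auto simp: nn_integral_cmult)
      also have "\<dots> \<le> 2 * ennreal (2 * M\<^sup>2) + 2 * ennreal (2 * M\<^sup>2)"
        using uV[of "\<sigma> k"] vV unfolding two by (intro add_mono mult_left_mono) auto
      also have "\<dots> = ennreal (2 * (2 * M\<^sup>2) + 2 * (2 * M\<^sup>2))"
        by (simp only: ennreal_plus ennreal_mult' ennreal_numeral zero_le_power2 mult_nonneg_nonneg zero_le_numeral)
      finally show "(\<integral>\<^sup>+ x. ennreal (V x * (u (\<sigma> k) x - v x)\<^sup>2) \<partial>lebesgue) \<le> ennreal (8 * M\<^sup>2)" by simp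
    qed measurable
    moreover have "AE x in lebesgue. (\<lambda>k. u (\<sigma> k) x - v x) \<longlonglongrightarrow> 0"
      using lim by eventually_elim (rule LIM_zero)
    ultimately have "(\<lambda>k. \<integral>\<^sup>+ x. ennreal (W x * \<bar>u (\<sigma> k) x - v x\<bar> powr \<tau>) \<partial>lebesgue) \<longlonglongrightarrow> 0"
      using A[of M] by (intro admissible_tendsto_0[of "2 * (B * H)" "8 * M\<^sup>2"]) (auto simp: H_def)
    with \<sigma> vL show ?thesis by blast
  qed
  with sub show ?thesis unfolding compact_embedding_rad_def by blast
qed

end

theorem theorem2p13:
  fixes V W \<phi> :: "'a::euclidean_space \<Rightarrow> real"
    and \<tau>bar R C :: real
  assumes "DIM('a) \<ge> 2"
    and "continuous_on UNIV V" and "continuous_on UNIV W"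
    and "\<exists>c>0. \<forall>x. c \<le> V x" and "\<exists>c>0. \<forall>x. c \<le> W x"
    and "\<forall>x. 0 \<le> \<phi> x" and "(\<phi> \<longlongrightarrow> 0) at_infinity"
    and "\<tau>bar > 2" and "R > 0" and "C > 0"
    and "\<forall>x. norm x \<ge> R \<longrightarrow>
           W x \<le> C * \<phi> x * V x * norm x powr ((real DIM('a) - 1) * (\<tau>bar - 2) / 2)"
  shows "\<forall>\<tau>. \<tau>bar \<le> \<tau> \<and> (DIM('a) = 2 \<or> \<tau> < 2 * real DIM('a) / (real DIM('a) - 2))
           \<longrightarrow> compact_embedding_rad V W \<tau>"
proof (intro allI impI)
  fix \<tau> assume \<tau>: "\<tau>bar \<le> \<tau> \<and> (DIM('a) = 2 \<or> \<tau> < 2 * real DIM('a) / (real DIM('a) - 2))"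
  define N where "N = real DIM('a)"
  have N: "2 \<le> N" using assms(1) by (simp add: N_def)
  have \<tau>0: "0 < \<tau>" using \<tau> assms(8) by linarith
  have "(N - 2) / 2 < N / \<tau>"
  proof (cases "DIM('a) = 2")
    case True
    then show ?thesis using \<tau>0 by (simp add: N_def)
  next
    case False
    then have "2 < N" using assms(1) by (simp add: N_def)
    moreover have "\<tau> < 2 * N / (N - 2)" using \<tau> False by (simp add: N_def)
    ultimately show ?thesis using \<tau>0 by (simp add: field_simps)
  qed
  then obtain \<alpha> where \<alpha>: "(N - 2) / 2 < \<alpha>" "\<alpha> < N / \<tau>" using dense by blast
  obtain c0 where c0: "0 < c0" "\<And>x. c0 \<le> V x" using assms(4) by blast
  obtain c1 where c1: "0 < c1" "\<And>x. c1 \<le> W x" using assms(5) by blast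
  interpret radial_embedding V W \<phi> \<tau>bar R C c0 \<tau> \<alpha>
  proof
    show "0 \<le> W x" for x using c1(1) c1(2)[of x] by linarith
    show "0 < \<alpha>" using \<alpha>(1) N by (simp add: field_simps)
    show "real DIM('a) - 2 \<le> 2 * \<alpha>" using \<alpha>(1) by (simp add: N_def)
    show "\<alpha> * \<tau> < real DIM('a)" using \<alpha>(2) \<tau>0 by (simp add: N_def field_simps)
    show "W x \<le> C * \<phi> x * V x * norm x powr (real (DIM('a) - 1) * (\<tau>bar - 2) / 2)" if "R \<le> norm x" for x
      using assms(11) that by (simp add: of_nat_diff)
  qed (use assms c0 \<tau> in auto)
  show "compact_embedding_rad V W \<tau>" by (rule compact_embedding)
qed

end
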